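(* Let $(G,\rho,\omega)$ be a reversible random network, where $\omega:E(G)\to\mathbb R_+$ is a random edge weight carried as a mark, with $\mathbb E[1/c^G_\rho]<\infty$ and such that almost surely \[ \lim_{R\to\infty}\frac{\log\log \mathrm{vol}^G(\rho,R)}{\log R}=0. \] Suppose moreover that $\mathbb E[\omega(X_0,X_1)^2]<\infty$, where $\{X_n\}$ is the random walk on $G$ started from $X_0=\rho$. Then for every $\delta>0$, almost surely, for all sufficiently large $n$, \[ \mathbb E\Big[\max_{0\le t\le n}\mathrm{dist}^G_\omega(X_0,X_t)^2\ \Big|\ (G,\rho,\omega)\Big]\le n^{1+\delta}. \]
   Context: A random rooted network $(G,\rho,c^G,\xi)$ consists of a random locally finite connected graph $G$ (self-loops allowed), a root $\rho$, edge conductances $c^G:E(G)\to[0,\infty)$ and a marking $\xi$ (here $\xi=\omega$). Write $c^G_u=\sum_{v:\{u,v\}\in E(G)}c^G(\{u,v\})$. The random walk $\{X_n\}$ has $X_0=\rho$ and $\Pr[X_{n+1}=v\mid X_n=u]=c^G(\{u,v\})/c^G_u$. The network is reversible if a.s. $c^G_\rho>0$ and $(G,X_0,X_1,c^G,\xi)$ and $(G,X_1,X_0,c^G,\xi)$ have the same law. $B^G(x,R)$ is the ball in the graph distance, $\mathrm{vol}^G(x,R)=\sum_{y\in B^G(x,R)}c^G_y$. $\omega(X_0,X_1)$ denotes $\omega(\{X_0,X_1\})$. $\mathrm{dist}^G_\omega$ is the $\omega$-weighted path (pseudo)metric: the infimum over paths in $G$ between two vertices of the sum of $\omega$ over the path's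 edges. *)

theory Defs
  imports "HOL-Probability.Probability"
begin

text \<open>A (labelled) rooted network: vertex set, symmetric adjacency relation
(self-loops allowed), edge conductances, root and edge marks (the weights omega).
Conductances and marks are normalised to 0 off the edge set.\<close>

record net =
  verts :: "nat set"
  adj   :: "nat \<Rightarrow> nat \<Rightarrow> bool"
  cond  :: "nat \<Rightarrow> nat \<Rightarrow> real"
  root  :: nat
  mark  :: "nat \<Rightarrow> nat \<Rightarrow> real"

definition nbrs :: "net \<Rightarrow> nat \<Rightarrow> nat set" where
  "nbrs N u = {v. adj N u v}"

definition cvert :: "net \<Rightarrow> nat \<Rightarrow> real" where
  "cvert N u = (\<Sum>v\<in>nbrs N u. cond N u v)"

definition wf_net :: "net \<Rightarrow> bool" where
  "wf_net N \<longleftrightarrow>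
     root N \<in> verts N \<and>
     (\<forall>u v. adj N u v \<longrightarrow> u \<in> verts N \<and> v \<in> verts N) \<and>
     (\<forall>u v. adj N u v = adj N v u) \<and>
     (\<forall>u v. cond N u v = cond N v u \<and> mark N u v = mark N v u) \<and>
     (\<forall>u v. adj N u v \<longrightarrow> cond N u v \<ge> 0 \<and> mark N u v \<ge> 0) \<and>
     (\<forall>u v. \<not> adj N u v \<longrightarrow> cond N u v = 0 \<and> mark N u v = 0) \<and>
     (\<forall>u. finite (nbrs N u)) \<and>
     (\<forall>u\<in>verts N. \<forall>v\<in>verts N. (u, v) \<in> {(x, y). adj N x y}\<^sup>*)"

text \<open>Paths in the graph, as nonempty vertex lists with consecutive vertices adjacent.\<close>
definition is_path :: "net \<Rightarrow> nat list \<Rightarrow> bool" where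
  "is_path N xs \<longleftrightarrow> xs \<noteq> [] \<and> (\<forall>i < length xs - 1. adj N (xs ! i) (xs ! Suc i))"

definition ball :: "net \<Rightarrow> nat \<Rightarrow> real \<Rightarrow> nat set" where
  "ball N x R = {y. \<exists>xs. is_path N xs \<and> hd xs = x \<and> last xs = y \<and> real (length xs - 1) \<le> R}"

definition vol :: "net \<Rightarrow> nat \<Rightarrow> real \<Rightarrow> real" where
  "vol N x R = (\<Sum>y\<in>ball N x R. cvert N y)"

text \<open>omega-weighted path pseudometric.\<close>
definition path_weight :: "net \<Rightarrow> nat list \<Rightarrow> real" where
  "path_weight N xs = (\<Sum>i<length xs - 1. mark N (xs ! i) (xs ! Suc i))"

definition wdist :: "net \<Rightarrow> nat \<Rightarrow> nat \<Rightarrow> real" where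
  "wdist N x y = Inf {path_weight N xs | xs. is_path N xs \<and> hd xs = x \<and> last xs = y}"

definition trans_prob :: "net \<Rightarrow> nat \<Rightarrow> nat \<Rightarrow> real" where
  "trans_prob N u v = cond N u v / cvert N u"

text \<open>Walk trajectories (X_0,...,X_n) started at the root, and their quenched probabilities.\<close>
definition walks :: "net \<Rightarrow> nat \<Rightarrow> nat list set" where
  "walks N n = {xs. length xs = Suc n \<and> hd xs = root N \<and> is_path N xs}"

definition walk_prob :: "net \<Rightarrow> nat list \<Rightarrow> real" where
  "walk_prob N xs = (\<Prod>i<length xs - 1. trans_prob N (xs ! i) (xs ! Suc i))"

text \<open>E[ max_{0<=t<=n} dist_omega(X_0,X_t)^2 | (G,rho,omega) ].\<close>
definition quenched_max_sq :: "net \<Rightarrow> nat \<Rightarrow> real" where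
  "quenched_max_sq N n =
     (\<Sum>xs\<in>walks N n. walk_prob N xs * Max {(wdist N (root N) (xs ! t))\<^sup>2 | t. t \<le> n})"

text \<open>Product sigma-algebra on labelled networks generated by the coordinates.\<close>
definition net_sa :: "net measure" where
  "net_sa = sigma UNIV
     ((\<lambda>u. {N. u \<in> verts N}) ` UNIV \<union>
      (\<lambda>(u, v). {N. adj N u v}) ` UNIV \<union>
      (\<lambda>u. {N. root N = u}) ` UNIV \<union>
      {{N. cond N u v \<in> B} | u v B. open B} \<union>
      {{N. mark N u v \<in> B} | u v B. open B})"

definition relabel :: "(nat \<Rightarrow> nat) \<Rightarrow> net \<Rightarrow> net" where
  "relabel \<pi> N = \<lparr> verts = \<pi> ` verts N,
                    adj = (\<lambda>u v. adj N (inv \<pi> u) (inv \<pi> v)),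
                    cond = (\<lambda>u v. cond N (inv \<pi> u) (inv \<pi> v)),
                    root = \<pi> (root N),
                    mark = (\<lambda>u v. mark N (inv \<pi> u) (inv \<pi> v)) \<rparr>"

text \<open>Functions of doubly rooted networks (N with root, plus a second root v)
that are invariant under isomorphism (relabelling).\<close>
definition iso_invariant :: "(net \<Rightarrow> nat \<Rightarrow> ennreal) \<Rightarrow> bool" where
  "iso_invariant F \<longleftrightarrow> (\<forall>\<pi> N v. bij \<pi> \<longrightarrow> F (relabel \<pi> N) (\<pi> v) = F N v)"

text \<open>Reversibility: c_rho > 0 a.s. and (G,X_0,X_1,c,omega) has the same law
(up to isomorphism) as (G,X_1,X_0,c,omega).\<close>
definition reversible_net :: "net measure \<Rightarrow> bool" where
  "reversible_net M \<longleftrightarrow>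
     (AE N in M. cvert N (root N) > 0) \<and>
     (\<forall>F. case_prod F \<in> borel_measurable (net_sa \<Otimes>\<^sub>M count_space UNIV) \<and> iso_invariant F \<longrightarrow>
        (\<integral>\<^sup>+ N. (\<Sum>v\<in>nbrs N (root N). ennreal (trans_prob N (root N) v) * F N v) \<partial>M) =
        (\<integral>\<^sup>+ N. (\<Sum>v\<in>nbrs N (root N). ennreal (trans_prob N (root N) v) * F (N\<lparr>root := v\<rparr>) (root N)) \<partial>M))"

end

theory Submission
  imports Defs
begin

text \<open>
For a fixed base point \<open>z\<close> the function \<open>f = dist\<^sub>\<omega>(z, \<cdot>)\<close> is 1-Lipschitz, and the Lyons--Zheng
decomposition writes \<open>2 (f(X\<^sub>t) - f(X\<^sub>0))\<close> as a forward martingale minus a martingale of the reversed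
walk, up to drift terms dominated by the one-step energy. With \<open>z = X\<^sub>0\<close> the base point of the backward
martingale is the endpoint of the reversed walk, so that martingale must be bounded simultaneously
for all admissible base points. A maximum of \<open>K\<close> martingales costs only a factor \<open>log K\<close> in the
second moment (the type 2 constant of \<open>\<ell>\<^sub>\<infinity>\<^sup>K\<close>, obtained from the smooth potential
\<open>(1 + \<Sum>\<^sub>a x\<^sub>a\<^sup>2\<^sup>m)\<^sup>1\<^sup>/\<^sup>m\<close> with \<open>m \<approx> log K\<close>), and the volume hypothesis gives \<open>log K \<le> n\<^sup>o\<^sup>(\<^sup>1\<^sup>)\<close>.
Reversibility bounds the annealed expectation by \<open>n\<^sup>1\<^sup>+\<^sup>o\<^sup>(\<^sup>1\<^sup>)\<close>; summing over dyadic times and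
monotonicity in \<open>n\<close> give the almost sure quenched bound.
\<close>

section \<open>Measurability on the space of networks\<close>

text \<open>For a fixed network the law of the walk started at the root is not invariant under
  reversal, so time may be reversed only after integrating over the network. The volume and
  conductance bounds, however, hold only from a random time on and cannot be imposed before
  integrating. The truncation in \<open>back_term\<close> reconciles the two. It tests the start of
  the walk, after reversal its endpoint, against a deterministic threshold \<open>D\<close>, so its
  mean is controlled over all networks; for almost every fixed network the test at the root is
  eventually passed, and the truncation then has no effect. At time n = 2^k the threshold is about
  2^(n^(2e)). At most D^2 base points survive, and a logarithmic loss in their number is of order
  n^(2e). Summing separate second moment bounds over the base points would cost the factor D^2
  itself, which no power of n dominates; this forces the vector-valued potential.\<close>

lemma space_net_sa [simp]: "space net_sa = UNIV"
  by (simp add: net_sa_def)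

lemma net_sa_generator:
  assumes "A \<in> (\<lambda>u. {N. u \<in> verts N}) ` UNIV \<union>
      (\<lambda>(u, v). {N. adj N u v}) ` UNIV \<union>
      (\<lambda>u. {N. root N = u}) ` UNIV \<union>
      {{N. cond N u v \<in> B} | u v B. open B} \<union>
      {{N. mark N u v \<in> B} | u v B. open B}"
  shows "A \<in> sets net_sa"
  unfolding net_sa_def using assms by (subst sets_measure_of) auto

lemma measurable_adj [measurable]: "Measurable.pred net_sa (\<lambda>N. adj N u v)"
  unfolding pred_def by (simp, rule net_sa_generator) auto

lemma measurable_root [measurable]: "root \<in> measurable net_sa (count_space UNIV)"
proof (rule measurable_count_space_eq2_countable[THEN iffD2])
  show "root \<in> space net_sa \<rightarrow> UNIV \<and> (\<forall>a\<in>UNIV. root -` {a} \<inter> space net_sa \<in> sets net_sa)"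
    by (auto simp: vimage_def intro!: net_sa_generator)
qed

lemma measurable_cond [measurable]: "(\<lambda>N. cond N u v) \<in> borel_measurable net_sa"
  by (rule borel_measurableI) (auto simp: vimage_def intro!: net_sa_generator)

lemma measurable_mark [measurable]: "(\<lambda>N. mark N u v) \<in> borel_measurable net_sa"
  by (rule borel_measurableI) (auto simp: vimage_def intro!: net_sa_generator)

text \<open>There are only countably many finite sets of naturals, so a sum over a random one is a
  countable case distinction. Replacing an infinite \<open>T x\<close> by the empty set changes
  nothing, since a sum over an infinite set is 0 by convention.\<close>

lemma borel_measurable_sum_random_set:
  fixes g :: "nat \<Rightarrow> 'a \<Rightarrow> 'b::{second_countable_topology, topological_comm_monoid_add}"
  assumes T: "\<And>v. Measurable.pred M (\<lambda>x. v \<in> T x)"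
    and g: "\<And>v. g v \<in> borel_measurable M"
  shows "(\<lambda>x. \<Sum>v\<in>T x. g v x) \<in> borel_measurable M"
proof -
  define T' where "T' x = (if finite (T x) then T x else {})" for x
  have fin: "finite (T x) \<longleftrightarrow> (\<exists>k. \<forall>v. v \<in> T x \<longrightarrow> v \<le> k)" for x
    by (simp add: finite_nat_set_iff_bounded_le Ball_def)
  have pfin: "Measurable.pred M (\<lambda>x. finite (T x))"
    unfolding fin using T by measurable
  have "T' \<in> measurable M (count_space (Collect finite))"
  proof (rule measurable_count_space_eq_countable[THEN iffD2])
    show "countable (Collect finite :: nat set set)"
      using countable_Collect_finite by blast
    have "Measurable.pred M (\<lambda>x. T' x = F)" if "finite F" for F
    proof -
      have "T' x = F \<longleftrightarrow> (if finite (T x) then \<forall>v. v \<in> T x \<longleftrightarrow> v \<in> F else F = {})" for x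
        by (auto simp: T'_def)
      then show ?thesis using T pfin by simp
    qed
    then show "T' \<in> space M \<rightarrow> Collect finite \<and>
        (\<forall>a\<in>Collect finite. T' -` {a} \<inter> space M \<in> sets M)"
      by (auto simp: T'_def pred_def vimage_def Int_def conj_commute)
  qed
  then have "(\<lambda>x. \<Sum>v\<in>T' x. g v x) \<in> borel_measurable M"
    by (rule measurable_compose_countable'[where f = "\<lambda>F x. \<Sum>v\<in>F. g v x", rotated])
       (use g countable_Collect_finite in auto)
  also have "(\<lambda>x. \<Sum>v\<in>T' x. g v x) = (\<lambda>x. \<Sum>v\<in>T x. g v x)"
    by (auto simp: T'_def)
  finally show ?thesis .
qed

lemma measurable_in_nbrs [measurable]: "Measurable.pred net_sa (\<lambda>N. v \<in> nbrs N u)"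
  by (simp add: nbrs_def)

lemma measurable_cvert [measurable]: "(\<lambda>N. cvert N u) \<in> borel_measurable net_sa"
  unfolding cvert_def by (rule borel_measurable_sum_random_set) measurable

lemma measurable_trans_prob [measurable]: "(\<lambda>N. trans_prob N u v) \<in> borel_measurable net_sa"
  unfolding trans_prob_def by measurable

lemma measurable_is_path [measurable]: "Measurable.pred net_sa (\<lambda>N. is_path N xs)"
  unfolding is_path_def by measurable

lemma measurable_path_weight [measurable]: "(\<lambda>N. path_weight N xs) \<in> borel_measurable net_sa"
  unfolding path_weight_def by measurable

lemma measurable_in_ball [measurable]: "Measurable.pred net_sa (\<lambda>N. y \<in> ball N x R)"
  unfolding ball_def by simp

lemma measurable_vol [measurable]: "(\<lambda>N. vol N x R) \<in> borel_measurable net_sa"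
  unfolding vol_def by (rule borel_measurable_sum_random_set) measurable

text \<open>A version of \<open>wdist\<close> that is measurable and relabelling invariant on all networks: the real
  infimum in \<open>wdist\<close> is a junk value off the well-formed ones.\<close>

definition edist :: "net \<Rightarrow> nat \<Rightarrow> nat \<Rightarrow> ennreal" where
  "edist N x y = (INF xs. if is_path N xs \<and> hd xs = x \<and> last xs = y
     then ennreal (path_weight N xs) else \<infinity>)"

definition rdist :: "net \<Rightarrow> nat \<Rightarrow> nat \<Rightarrow> real" where
  "rdist N x y = enn2real (edist N x y)"

lemma measurable_rdist [measurable]: "(\<lambda>N. rdist N x y) \<in> borel_measurable net_sa"
  unfolding rdist_def edist_def by measurable

section \<open>Relabelling\<close>

lemma adj_relabel: "bij \<pi> \<Longrightarrow> adj (relabel \<pi> N) (\<pi> u) (\<pi> v) = adj N u v"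
  and cond_relabel: "bij \<pi> \<Longrightarrow> cond (relabel \<pi> N) (\<pi> u) (\<pi> v) = cond N u v"
  and mark_relabel: "bij \<pi> \<Longrightarrow> mark (relabel \<pi> N) (\<pi> u) (\<pi> v) = mark N u v"
  and root_relabel: "root (relabel \<pi> N) = \<pi> (root N)"
  by (simp_all add: relabel_def bij_is_inj)

lemma nbrs_relabel:
  assumes "bij \<pi>"
  shows "nbrs (relabel \<pi> N) (\<pi> u) = \<pi> ` nbrs N u"
proof -
  have "v \<in> nbrs (relabel \<pi> N) (\<pi> u) \<longleftrightarrow> v \<in> \<pi> ` nbrs N u" for v
  proof -
    obtain w where "v = \<pi> w" using assms by (metis bij_pointE)
    then show ?thesis
      using assms by (auto simp: nbrs_def adj_relabel bij_is_inj inj_image_mem_iff)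
  qed
  then show ?thesis by blast
qed

lemma sum_relabel:
  assumes "bij \<pi>"
  shows "(\<Sum>v\<in>\<pi> ` A. g v) = (\<Sum>v\<in>A. g (\<pi> v))"
  using assms by (subst sum.reindex) (auto intro: inj_on_subset[OF bij_is_inj])

lemma cvert_relabel: "bij \<pi> \<Longrightarrow> cvert (relabel \<pi> N) (\<pi> u) = cvert N u"
  by (simp add: cvert_def nbrs_relabel sum_relabel cond_relabel)

lemma trans_prob_relabel: "bij \<pi> \<Longrightarrow> trans_prob (relabel \<pi> N) (\<pi> u) (\<pi> v) = trans_prob N u v"
  by (simp add: trans_prob_def cvert_relabel cond_relabel)

lemma is_path_relabel: "bij \<pi> \<Longrightarrow> is_path (relabel \<pi> N) (map \<pi> xs) = is_path N xs"
  by (auto simp: is_path_def adj_relabel)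

lemma path_weight_relabel: "bij \<pi> \<Longrightarrow> path_weight (relabel \<pi> N) (map \<pi> xs) = path_weight N xs"
  unfolding path_weight_def by (rule sum.cong) (auto simp: mark_relabel)

text \<open>The empty list is split off because \<open>hd\<close> and \<open>last\<close> need not
  commute with \<open>map\<close> there; it is never a path, so both sides fail.\<close>

lemma path_between_relabel:
  assumes "bij \<pi>"
  shows "is_path (relabel \<pi> N) (map \<pi> xs) \<and> hd (map \<pi> xs) = \<pi> x \<and> last (map \<pi> xs) = \<pi> y \<longleftrightarrow>
    is_path N xs \<and> hd xs = x \<and> last xs = y"
proof (cases "xs = []")
  case False
  then show ?thesis
    using assms by (simp add: is_path_relabel hd_map last_map bij_is_inj inj_eq)
qed (simp add: is_path_def)

lemma surj_map: "surj \<pi> \<Longrightarrow> surj (map \<pi>)"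
  by (rule surjI[where f = "map (inv \<pi>)"]) (simp add: map_idI surj_f_inv_f)

lemma edist_relabel:
  assumes "bij \<pi>"
  shows "edist (relabel \<pi> N) (\<pi> x) (\<pi> y) = edist N x y"
proof -
  have "edist (relabel \<pi> N) (\<pi> x) (\<pi> y) = (INF xs\<in>range (map \<pi>). if is_path (relabel \<pi> N) xs \<and>
      hd xs = \<pi> x \<and> last xs = \<pi> y then ennreal (path_weight (relabel \<pi> N) xs) else \<infinity>)"
    unfolding edist_def using surj_map[OF bij_is_surj[OF assms]] by simp
  also have "\<dots> = edist N x y"
    unfolding image_image path_between_relabel[OF assms] path_weight_relabel[OF assms] edist_def ..
  finally show ?thesis .
qed

lemma rdist_relabel: "bij \<pi> \<Longrightarrow> rdist (relabel \<pi> N) (\<pi> x) (\<pi> y) = rdist N x y"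
  by (simp add: rdist_def edist_relabel)

lemma ball_relabel:
  assumes "bij \<pi>"
  shows "ball (relabel \<pi> N) (\<pi> x) R = \<pi> ` ball N x R"
proof (rule set_eqI)
  fix y'
  obtain y where y: "y' = \<pi> y" using assms by (metis bij_pointE)
  let ?P = "\<lambda>xs. (is_path (relabel \<pi> N) xs \<and> hd xs = \<pi> x \<and> last xs = \<pi> y) \<and> real (length xs - 1) \<le> R"
  have "y' \<in> ball (relabel \<pi> N) (\<pi> x) R \<longleftrightarrow> (\<exists>xs. ?P xs)"
    by (simp add: ball_def y)
  also have "\<dots> \<longleftrightarrow> (\<exists>xs\<in>range (map \<pi>). ?P xs)"
    by (simp only: surj_map[OF bij_is_surj[OF assms]] bex_UNIV)
  also have "\<dots> \<longleftrightarrow> (\<exists>xs. ?P (map \<pi> xs))"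
    by blast
  also have "\<dots> \<longleftrightarrow> y \<in> ball N x R"
    unfolding path_between_relabel[OF assms] ball_def by simp
  also have "\<dots> \<longleftrightarrow> y' \<in> \<pi> ` ball N x R"
    using assms by (simp add: y bij_is_inj inj_image_mem_iff)
  finally show "y' \<in> ball (relabel \<pi> N) (\<pi> x) R \<longleftrightarrow> y' \<in> \<pi> ` ball N x R" .
qed

lemma vol_relabel: "bij \<pi> \<Longrightarrow> vol (relabel \<pi> N) (\<pi> x) R = vol N x R"
  by (simp add: vol_def ball_relabel sum_relabel cvert_relabel)

lemma nbrs_set_root [simp]: "nbrs (N\<lparr>root := r\<rparr>) u = nbrs N u"
  by (simp add: nbrs_def)

lemma cvert_set_root [simp]: "cvert (N\<lparr>root := r\<rparr>) u = cvert N u"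
  by (simp add: cvert_def)

lemma trans_prob_set_root [simp]: "trans_prob (N\<lparr>root := r\<rparr>) u v = trans_prob N u v"
  by (simp add: trans_prob_def)

lemma is_path_set_root [simp]: "is_path (N\<lparr>root := r\<rparr>) xs = is_path N xs"
  by (simp add: is_path_def)

lemma path_weight_set_root [simp]: "path_weight (N\<lparr>root := r\<rparr>) xs = path_weight N xs"
  by (simp add: path_weight_def)

lemma rdist_set_root [simp]: "rdist (N\<lparr>root := r\<rparr>) x y = rdist N x y"
  by (simp add: rdist_def edist_def)

lemma vol_set_root [simp]: "vol (N\<lparr>root := r\<rparr>) x R = vol N x R"
  by (simp add: vol_def ball_def)

section \<open>Path expectations and time reversal\<close>

text \<open>Recursion on the first step turns measurability, equivariance and the martingale
  estimates into one-step inductions, and values in \<open>ennreal\<close> avoid integrability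
  conditions. On well-formed networks \<open>walk_expect_eq_sum\<close> recovers the sum over
  trajectories.\<close>

fun walk_expect :: "net \<Rightarrow> nat \<Rightarrow> nat \<Rightarrow> (nat list \<Rightarrow> ennreal) \<Rightarrow> ennreal" where
  "walk_expect N 0 u \<Phi> = \<Phi> [u]"
| "walk_expect N (Suc n) u \<Phi> =
     (\<Sum>v\<in>nbrs N u. ennreal (trans_prob N u v) * walk_expect N n v (\<lambda>xs. \<Phi> (u # xs)))"

lemma is_path_Cons:
  assumes "ys \<noteq> []"
  shows "is_path N (u # ys) \<longleftrightarrow> adj N u (hd ys) \<and> is_path N ys"
proof -
  obtain v zs where "ys = v # zs" using assms by (cases ys) auto
  then show ?thesis
    by (auto simp: is_path_def less_Suc_eq_0_disj all_conj_distrib)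
qed

lemma walk_expect_mono:
  assumes "\<And>xs. length xs = Suc n \<Longrightarrow> hd xs = u \<Longrightarrow> is_path N xs \<Longrightarrow> \<Phi> xs \<le> \<Psi> xs"
  shows "walk_expect N n u \<Phi> \<le> walk_expect N n u \<Psi>"
  using assms
proof (induction n arbitrary: u \<Phi> \<Psi>)
  case 0
  show ?case by (simp, rule 0) (auto simp: is_path_def)
next
  case (Suc n)
  have "walk_expect N n v (\<lambda>xs. \<Phi> (u # xs)) \<le> walk_expect N n v (\<lambda>xs. \<Psi> (u # xs))"
    if "v \<in> nbrs N u" for v
  proof (intro Suc.IH Suc.prems)
    fix xs assume "length xs = Suc n" "hd xs = v" "is_path N xs"
    moreover from this have "xs \<noteq> []" by auto
    ultimately show "length (u # xs) = Suc (Suc n)" "hd (u # xs) = u" "is_path N (u # xs)"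
      using that by (simp_all add: is_path_Cons nbrs_def)
  qed
  then show ?case by (auto intro!: sum_mono mult_left_mono)
qed

lemma walk_expect_cong:
  assumes "\<And>xs. length xs = Suc n \<Longrightarrow> hd xs = u \<Longrightarrow> is_path N xs \<Longrightarrow> \<Phi> xs = \<Psi> xs"
  shows "walk_expect N n u \<Phi> = walk_expect N n u \<Psi>"
  using assms by (intro antisym walk_expect_mono) auto

lemma walk_expect_add:
  "walk_expect N n u (\<lambda>xs. \<Phi> xs + \<Psi> xs) = walk_expect N n u \<Phi> + walk_expect N n u \<Psi>"
  by (induction n arbitrary: u \<Phi> \<Psi>) (simp_all add: distrib_left sum.distrib)

lemma walk_expect_cmult:
  "walk_expect N n u (\<lambda>xs. c * \<Phi> xs) = c * walk_expect N n u \<Phi>"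
  by (induction n arbitrary: u \<Phi>) (simp_all add: sum_distrib_left mult.left_commute)

lemma walk_expect_zero [simp]: "walk_expect N n u (\<lambda>xs. 0) = 0"
  by (induction n arbitrary: u) simp_all

lemma walk_expect_sum:
  "walk_expect N n u (\<lambda>xs. \<Sum>a\<in>A. \<Phi> a xs) = (\<Sum>a\<in>A. walk_expect N n u (\<Phi> a))"
  by (induction A rule: infinite_finite_induct) (simp_all add: walk_expect_add)

text \<open>Reversal turns a step prepended to a path into a step appended to it, so the recursion
  is also required at the far end.\<close>

lemma walk_expect_snoc:
  "walk_expect N (Suc n) u \<Phi> = walk_expect N n u
     (\<lambda>xs. \<Sum>v\<in>nbrs N (last xs). ennreal (trans_prob N (last xs) v) * \<Phi> (xs @ [v]))"
proof (induction n arbitrary: u \<Phi>)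
  case (Suc n)
  have "walk_expect N (Suc n) v (\<lambda>xs. \<Phi> (u # xs)) = walk_expect N n v
     (\<lambda>xs. \<Sum>w\<in>nbrs N (last (u # xs)). ennreal (trans_prob N (last (u # xs)) w) * \<Phi> (u # xs @ [w]))" for v
    unfolding Suc.IH by (rule walk_expect_cong) auto
  then show ?case by (subst walk_expect.simps(2)) simp
qed simp

lemma measurable_walk_expect:
  assumes "\<And>xs. (\<lambda>N. \<Phi> N xs) \<in> borel_measurable net_sa"
  shows "(\<lambda>N. walk_expect N n u (\<Phi> N)) \<in> borel_measurable net_sa"
  using assms
proof (induction n arbitrary: u \<Phi>)
  case (Suc n)
  have [measurable]: "(\<lambda>N. walk_expect N n v (\<lambda>xs. \<Phi> N (u # xs))) \<in> borel_measurable net_sa" for v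
    by (rule Suc.IH) (rule Suc.prems)
  show ?case
    by (simp, rule borel_measurable_sum_random_set) measurable
qed simp

lemma measurable_at_root:
  assumes "\<And>u. (\<lambda>N. f N u) \<in> borel_measurable net_sa"
  shows "(\<lambda>N. f N (root N)) \<in> borel_measurable net_sa"
  by (rule measurable_compose_countable[where f = "\<lambda>u N. f N u"]) (use assms in measurable)

lemma walk_expect_relabel:
  assumes "bij \<pi>"
  shows "walk_expect (relabel \<pi> N) n (\<pi> u) \<Phi> = walk_expect N n u (\<lambda>xs. \<Phi> (map \<pi> xs))"
  by (induction n arbitrary: u \<Phi>)
     (simp_all add: nbrs_relabel[OF assms] sum_relabel[OF assms] trans_prob_relabel[OF assms])

lemma walk_expect_set_root [simp]: "walk_expect (N\<lparr>root := r\<rparr>) n u \<Phi> = walk_expect N n u \<Phi>"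
  by (induction n arbitrary: u \<Phi>) simp_all

text \<open>Admissible functionals for time reversal. They read their base point from the path and
  never from \<open>root\<close>, because each application of reversibility moves the root. Empty
  lists are excluded from the invariance since \<open>hd []\<close> is not equivariant.\<close>

definition path_functional :: "(net \<Rightarrow> nat list \<Rightarrow> ennreal) \<Rightarrow> bool" where
  "path_functional \<Phi> \<longleftrightarrow>
     (\<forall>xs. (\<lambda>N. \<Phi> N xs) \<in> borel_measurable net_sa) \<and>
     (\<forall>N r xs. \<Phi> (N\<lparr>root := r\<rparr>) xs = \<Phi> N xs) \<and>
     (\<forall>\<pi> N xs. bij \<pi> \<longrightarrow> xs \<noteq> [] \<longrightarrow> \<Phi> (relabel \<pi> N) (map \<pi> xs) = \<Phi> N xs)"

text \<open>One use of reversibility exchanges X_0 and X_1. The rest of the walk then starts at the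
  root, and the former X_0 becomes a fresh neighbour of it, which \<open>\<Phi>'\<close> averages
  out. The induction hypothesis reverses the remaining path, and the fresh neighbour ends up as its
  last step.\<close>

lemma nn_integral_walk_expect_rev:
  assumes sets: "sets M = sets net_sa" and rev: "reversible_net M" and \<Phi>: "path_functional \<Phi>"
  shows "(\<integral>\<^sup>+ N. walk_expect N n (root N) (\<Phi> N) \<partial>M) =
    (\<integral>\<^sup>+ N. walk_expect N n (root N) (\<lambda>xs. \<Phi> N (rev xs)) \<partial>M)"
  using \<Phi>
proof (induction n arbitrary: \<Phi>)
  case (Suc n)
  have meas: "(\<lambda>N. \<Phi> N xs) \<in> borel_measurable net_sa"
    and root: "\<Phi> (N\<lparr>root := r\<rparr>) xs = \<Phi> N xs"
    and iso: "bij \<pi> \<Longrightarrow> xs \<noteq> [] \<Longrightarrow> \<Phi> (relabel \<pi> N) (map \<pi> xs) = \<Phi> N xs" for N r xs \<pi>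
    using Suc.prems by (auto simp: path_functional_def)
  define F where "F N v = walk_expect N n v (\<lambda>xs. \<Phi> N (root N # xs))" for N v
  define \<Phi>' where "\<Phi>' N xs = (\<Sum>u\<in>nbrs N (hd xs). ennreal (trans_prob N (hd xs) u) * \<Phi> N (u # xs))"
    for N xs
  have 1: "case_prod F \<in> borel_measurable (net_sa \<Otimes>\<^sub>M count_space UNIV)"
  proof -
    have [measurable]: "(\<lambda>N. F N v) \<in> borel_measurable net_sa" for v
      unfolding F_def using meas
      by (intro measurable_at_root[where f = "\<lambda>N u. walk_expect N n v (\<lambda>xs. \<Phi> N (u # xs))"]
          measurable_walk_expect)
    have "(\<lambda>x. F (fst x) (snd x)) \<in> borel_measurable (net_sa \<Otimes>\<^sub>M count_space UNIV)"
      by (rule measurable_compose_countable[where f = "\<lambda>v x. F (fst x) v"]) measurable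
    then show ?thesis by (simp add: case_prod_beta')
  qed
  have 2: "iso_invariant F"
    unfolding iso_invariant_def
  proof (intro allI impI)
    fix \<pi> :: "nat \<Rightarrow> nat" and N v assume \<pi>: "bij \<pi>"
    have "\<Phi> (relabel \<pi> N) (\<pi> (root N) # map \<pi> xs) = \<Phi> N (root N # xs)" for xs
      using iso[OF \<pi>, of "root N # xs" N] by simp
    then show "F (relabel \<pi> N) (\<pi> v) = F N v"
      by (simp add: F_def walk_expect_relabel[OF \<pi>] root_relabel)
  qed
  have 3: "path_functional \<Phi>'"
    unfolding path_functional_def
  proof (intro conjI allI impI)
    show "(\<lambda>N. \<Phi>' N xs) \<in> borel_measurable net_sa" for xs
      unfolding \<Phi>'_def using meas by (intro borel_measurable_sum_random_set) measurable
    show "\<Phi>' (N\<lparr>root := r\<rparr>) xs = \<Phi>' N xs" for N r xs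
      by (simp add: \<Phi>'_def root)
    show "\<Phi>' (relabel \<pi> N) (map \<pi> xs) = \<Phi>' N xs" if "bij \<pi>" "xs \<noteq> []" for \<pi> N xs
    proof -
      have "\<Phi> (relabel \<pi> N) (\<pi> u # map \<pi> xs) = \<Phi> N (u # xs)" for u
        using iso[OF that(1), of "u # xs" N] by simp
      then show ?thesis
        using that by (simp add: \<Phi>'_def hd_map nbrs_relabel sum_relabel trans_prob_relabel)
    qed
  qed
  have "(\<integral>\<^sup>+ N. walk_expect N (Suc n) (root N) (\<Phi> N) \<partial>M) =
      (\<integral>\<^sup>+ N. (\<Sum>v\<in>nbrs N (root N). ennreal (trans_prob N (root N) v) * F N v) \<partial>M)"
    by (simp add: F_def)
  also have "\<dots> = (\<integral>\<^sup>+ N. (\<Sum>v\<in>nbrs N (root N).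
      ennreal (trans_prob N (root N) v) * F (N\<lparr>root := v\<rparr>) (root N)) \<partial>M)"
    using rev 1 2 unfolding reversible_net_def by blast
  \<comment> \<open>After the exchange \<open>v\<close> is drawn independently of the walk from the
    root, so its average moves inside the path expectation.\<close>
  also have "\<dots> = (\<integral>\<^sup>+ N. walk_expect N n (root N) (\<Phi>' N) \<partial>M)"
  proof (intro nn_integral_cong)
    fix N
    have "(\<Sum>v\<in>nbrs N (root N). ennreal (trans_prob N (root N) v) * F (N\<lparr>root := v\<rparr>) (root N)) =
        walk_expect N n (root N)
          (\<lambda>xs. \<Sum>v\<in>nbrs N (root N). ennreal (trans_prob N (root N) v) * \<Phi> N (v # xs))"
      by (simp add: F_def root walk_expect_sum walk_expect_cmult)
    also have "\<dots> = walk_expect N n (root N) (\<Phi>' N)"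
      by (rule walk_expect_cong) (simp add: \<Phi>'_def)
    finally show "(\<Sum>v\<in>nbrs N (root N). ennreal (trans_prob N (root N) v) *
        F (N\<lparr>root := v\<rparr>) (root N)) = walk_expect N n (root N) (\<Phi>' N)" .
  qed
  also have "\<dots> = (\<integral>\<^sup>+ N. walk_expect N n (root N) (\<lambda>xs. \<Phi>' N (rev xs)) \<partial>M)"
    by (rule Suc.IH[OF 3])
  also have "\<dots> = (\<integral>\<^sup>+ N. walk_expect N (Suc n) (root N) (\<lambda>xs. \<Phi> N (rev xs)) \<partial>M)"
    unfolding walk_expect_snoc
    by (intro nn_integral_cong walk_expect_cong) (simp add: \<Phi>'_def hd_rev)
  finally show ?case .
qed simp

section \<open>A smooth substitute for the squared maximum\<close>

lemma second_order_upper_bound: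
  fixes f f' f'' :: "real \<Rightarrow> real"
  assumes "\<And>t. 0 \<le> t \<Longrightarrow> t \<le> 1 \<Longrightarrow> (f has_real_derivative f' t) (at t)"
    and "\<And>t. 0 \<le> t \<Longrightarrow> t \<le> 1 \<Longrightarrow> (f' has_real_derivative f'' t) (at t)"
    and le: "\<And>t. 0 \<le> t \<Longrightarrow> t \<le> 1 \<Longrightarrow> f'' t \<le> 2 * K"
  shows "f 1 \<le> f 0 + f' 0 + K"
proof -
  define diff where "diff k = (if k = 0 then f else if k = 1 then f' else f'')" for k :: nat
  have "\<exists>t. 0 < t \<and> t < 1 \<and>
      f 1 = (\<Sum>k<2. diff k 0 / fact k * 1 ^ k) + diff 2 t / fact 2 * 1 ^ 2"
  proof (rule Maclaurin)
    show "\<forall>k t. k < 2 \<and> 0 \<le> t \<and> t \<le> 1 \<longrightarrow> (diff k has_real_derivative diff (Suc k) t) (at t)"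
      using assms by (auto simp: diff_def less_Suc_eq numeral_2_eq_2)
  qed (auto simp: diff_def)
  then obtain t where "0 < t" "t < 1" "f 1 = f 0 + f' 0 + f'' t / 2"
    by (auto simp: diff_def numeral_2_eq_2)
  with le[of t] show ?thesis by simp
qed

text \<open>A substitute for Hoelder's inequality, and the place where \<open>m\<close> must be
  logarithmic in the number of coordinates. Entries above r / 2 are charged to the m-th powers and
  contribute 2; each smaller one contributes at most (r / 2)^(m - 1), and the bound on the
  cardinality cancels the power of 2, contributing 1.\<close>

lemma sum_power_pred_le:
  fixes w :: "'a \<Rightarrow> real"
  assumes fin: "finite I" and card: "real (card I) \<le> 2 ^ (m - 1)" and m: "m \<ge> 1" and r: "r > 0"
    and w: "\<And>a. a \<in> I \<Longrightarrow> 0 \<le> w a" and sum: "(\<Sum>a\<in>I. w a ^ m) \<le> r ^ m"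
  shows "(\<Sum>a\<in>I. w a ^ (m - 1)) \<le> 3 * r ^ (m - 1)"
proof -
  have m': "m = Suc (m - 1)" using m by simp
  have *: "w a ^ (m - 1) \<le> 2 / r * w a ^ m + (r / 2) ^ (m - 1)" if "a \<in> I" for a
  proof (cases "w a \<ge> r / 2")
    case True
    then have "w a ^ (m - 1) * (r / 2) \<le> w a ^ (m - 1) * w a"
      using w[OF that] by (intro mult_left_mono) auto
    also have "\<dots> = w a ^ m" by (subst (2) m') simp
    finally have "w a ^ (m - 1) \<le> 2 / r * w a ^ m" using r by (simp add: field_simps)
    then show ?thesis using r by (simp add: add_increasing2)
  next
    case False
    then have "w a ^ (m - 1) \<le> (r / 2) ^ (m - 1)"
      using w[OF that] by (intro power_mono) auto
    then show ?thesis using w[OF that] r by (simp add: add_increasing)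
  qed
  have "(\<Sum>a\<in>I. w a ^ (m - 1)) \<le> (\<Sum>a\<in>I. 2 / r * w a ^ m + (r / 2) ^ (m - 1))"
    by (rule sum_mono) (rule *)
  also have "\<dots> = 2 / r * (\<Sum>a\<in>I. w a ^ m) + real (card I) * (r / 2) ^ (m - 1)"
    by (simp only: sum.distrib sum_distrib_left sum_constant)
  also have "\<dots> \<le> 2 / r * r ^ m + 2 ^ (m - 1) * (r / 2) ^ (m - 1)"
    using r sum card by (intro add_mono mult_left_mono mult_right_mono) auto
  also have "\<dots> = 3 * r ^ (m - 1)"
    using r by (subst m') (simp add: power_divide)
  finally show ?thesis .
qed

text \<open>A smoothed squared norm of order 2 m. The summand 1 keeps the base of
  \<open>powr\<close> positive, so the function is smooth even at the origin; it survives as the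
  additive 1 in later bounds.\<close>

definition potential :: "'a set \<Rightarrow> nat \<Rightarrow> ('a \<Rightarrow> real) \<Rightarrow> real" where
  "potential I m x = (1 + (\<Sum>a\<in>I. x a ^ (2 * m))) powr (1 / real m)"

lemma potential_zero: "m \<ge> 1 \<Longrightarrow> potential I m (\<lambda>_. 0) = 1"
  by (simp add: potential_def zero_power)

lemma potential_nonneg: "0 \<le> potential I m x"
  by (simp add: potential_def)

lemma square_le_potential:
  assumes "finite I" "a \<in> I" "m \<ge> 1"
  shows "(x a)\<^sup>2 \<le> potential I m x"
proof -
  have "((x a)\<^sup>2) ^ m \<le> (\<Sum>a\<in>I. x a ^ (2 * m))"
    using assms member_le_sum[of a I "\<lambda>a. x a ^ (2 * m)"] by (simp add: power_mult)
  then have "(((x a)\<^sup>2) ^ m) powr (1 / real m) \<le> potential I m x"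
    unfolding potential_def by (intro powr_mono2) auto
  moreover have "(((x a)\<^sup>2) ^ m) powr (1 / real m) = (x a)\<^sup>2"
    using assms by (cases "x a = 0") (auto simp: powr_powr simp flip: powr_realpow)
  ultimately show ?thesis by simp
qed

text \<open>Taylor expansion to second order along the segment from x to x + y. The first-order term
  is kept exactly because it averages to 0 for centred \<open>y\<close>; the remainder is linear in
  \<open>m\<close> and does not depend on the base point \<open>x\<close>.\<close>

lemma potential_add_le:
  fixes x y :: "'a \<Rightarrow> real"
  assumes fin: "finite I" and card: "real (card I) \<le> 2 ^ (m - 1)" and m: "m \<ge> 1"
    and b: "\<And>a. a \<in> I \<Longrightarrow> \<bar>y a\<bar> \<le> b"
  shows "potential I m (\<lambda>a. x a + y a) \<le> potential I m x +
     (1 + (\<Sum>a\<in>I. x a ^ (2 * m))) powr (1 / real m - 1) * 2 * (\<Sum>a\<in>I. x a ^ (2 * m - 1) * y a) +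
     3 * (2 * real m - 1) * b\<^sup>2"
proof -
  define u where "u s a = x a + s * y a" for s a
  define T where "T s = 1 + (\<Sum>a\<in>I. u s a ^ (2 * m))" for s
  define T' where "T' s = (\<Sum>a\<in>I. 2 * real m * u s a ^ (2 * m - 1) * y a)" for s
  define T'' where "T'' s = (\<Sum>a\<in>I. 2 * real m * (2 * real m - 1) * u s a ^ (2 * m - 2) * (y a)\<^sup>2)" for s
  have T1: "T s \<ge> 1" for s
    unfolding T_def by (auto simp: power_mult intro!: sum_nonneg)
  have dT: "(T has_real_derivative T' s) (at s)" for s
    unfolding T_def T'_def u_def
    by (auto intro!: derivative_eq_intros sum.cong simp: mult_ac)
  have dT': "(T' has_real_derivative T'' s) (at s)" for s
  proof -
    have "real (2 * m - 1) = 2 * real m - 1" "2 * m - 1 - 1 = 2 * m - 2" using m by auto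
    then show ?thesis
      unfolding T'_def T''_def u_def
      by (auto intro!: derivative_eq_intros sum.cong simp: power2_eq_square mult_ac)
  qed
  let ?p = "1 / real m"
  define f where "f s = T s powr ?p" for s
  define f' where "f' s = ?p * T s powr (?p - 1) * T' s" for s
  define f'' where "f'' s = ?p * ((?p - 1) * T s powr (?p - 1 - 1) * T' s * T' s + T s powr (?p - 1) * T'' s)" for s
  have "f 1 \<le> f 0 + f' 0 + 3 * (2 * real m - 1) * b\<^sup>2"
  proof (rule second_order_upper_bound)
    fix s :: real
    have pos: "T s > 0" using T1[of s] by simp
    show "(f has_real_derivative f' s) (at s)"
      unfolding f_def f'_def
      by (rule DERIV_cong, rule has_real_derivative_powr[THEN DERIV_chain2], rule pos, rule dT) simp
    show "(f' has_real_derivative f'' s) (at s)"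
      unfolding f'_def f''_def
      apply (rule DERIV_cong)
       apply (rule DERIV_mult)
        apply (rule DERIV_cmult)
        apply (rule has_real_derivative_powr[THEN DERIV_chain2], rule pos, rule dT)
       apply (rule dT')
      apply (simp add: algebra_simps)
      done
    define r where "r = T s powr ?p"
    have r: "r > 0" "r ^ m = T s"
      using pos m by (auto simp: r_def powr_powr simp flip: powr_realpow)
    have "T s powr (?p - 1) = r / r ^ m"
      using pos by (simp add: powr_diff r) (simp add: r_def)
    also have "\<dots> = 1 / r ^ (m - 1)"
      using r(1) m by (cases m) auto
    finally have pr: "T s powr (?p - 1) = 1 / r ^ (m - 1)" .
    \<comment> \<open>With r the m-th root of \<open>T s\<close>, this cancels the factor
      \<open>T s powr (?p - 1)\<close>, which is 1 / r^(m - 1). The dependence on \<open>x\<close>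
      disappears here.\<close>
    have "(\<Sum>a\<in>I. ((u s a)\<^sup>2) ^ (m - 1)) \<le> 3 * r ^ (m - 1)"
    proof (rule sum_power_pred_le[OF fin card m r(1)])
      show "(\<Sum>a\<in>I. ((u s a)\<^sup>2) ^ m) \<le> r ^ m"
        unfolding r T_def by (simp add: power_mult)
    qed auto
    moreover have "((u s a)\<^sup>2) ^ (m - 1) = u s a ^ (2 * m - 2)" for a
      by (simp add: diff_mult_distrib2 flip: power_mult)
    ultimately have su: "(\<Sum>a\<in>I. u s a ^ (2 * m - 2)) \<le> 3 * r ^ (m - 1)" by simp
    have ev: "u s a ^ (2 * m - 2) \<ge> 0" for a
      by (rule zero_le_even_power) simp
    have "T'' s \<le> (\<Sum>a\<in>I. 2 * real m * (2 * real m - 1) * u s a ^ (2 * m - 2) * b\<^sup>2)"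
      unfolding T''_def using b m ev abs_le_square_iff
      by (intro sum_mono mult_left_mono mult_nonneg_nonneg) (auto simp: abs_le_square_iff[symmetric] order_trans[OF _ abs_ge_self])
    also have "\<dots> = 2 * real m * (2 * real m - 1) * b\<^sup>2 * (\<Sum>a\<in>I. u s a ^ (2 * m - 2))"
      by (simp add: sum_distrib_left mult_ac)
    also have "\<dots> \<le> 2 * real m * (2 * real m - 1) * b\<^sup>2 * (3 * r ^ (m - 1))"
      using m by (intro mult_left_mono[OF su]) auto
    finally have T''le: "T'' s \<le> 2 * real m * (2 * real m - 1) * b\<^sup>2 * (3 * r ^ (m - 1))" .
    \<comment> \<open>The outer power 1 / m is concave, so the part of the second derivative
      containing the square of \<open>T'\<close> is nonpositive and is dropped.\<close>
    have "(?p - 1) * (T s powr (?p - 1 - 1) * (T' s)\<^sup>2) \<le> 0"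
      using m by (intro mult_nonpos_nonneg) auto
    then have "f'' s \<le> ?p * (T s powr (?p - 1) * T'' s)"
      unfolding f''_def using m by (intro mult_left_mono) (auto simp: power2_eq_square mult_ac)
    also have "\<dots> \<le> ?p * (1 / r ^ (m - 1) * (2 * real m * (2 * real m - 1) * b\<^sup>2 * (3 * r ^ (m - 1))))"
      unfolding pr using r by (intro mult_left_mono T''le) auto
    also have "\<dots> = 2 * (3 * (2 * real m - 1) * b\<^sup>2)"
      using r m by (simp add: field_simps)
    finally show "f'' s \<le> 2 * (3 * (2 * real m - 1) * b\<^sup>2)" .
  qed
  moreover have "f 1 = potential I m (\<lambda>a. x a + y a)" "f 0 = potential I m x"
    by (simp_all add: f_def T_def u_def potential_def)
  moreover have "f' 0 = (1 + (\<Sum>a\<in>I. x a ^ (2 * m))) powr (?p - 1) * 2 * (\<Sum>a\<in>I. x a ^ (2 * m - 1) * y a)"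
  proof -
    have "T' 0 = 2 * real m * (\<Sum>a\<in>I. x a ^ (2 * m - 1) * y a)"
      by (simp add: T'_def u_def sum_distrib_left mult_ac)
    then show ?thesis using m by (simp add: f'_def T_def u_def)
  qed
  ultimately show ?thesis by simp
qed

section \<open>Quenched estimates\<close>

lemma finite_nbrs: "wf_net N \<Longrightarrow> finite (nbrs N u)"
  by (simp add: wf_net_def)

lemma wf_net_adj:
  assumes "wf_net N" "adj N u v"
  shows "adj N v u" "u \<in> verts N" "v \<in> verts N" "0 \<le> cond N u v" "0 \<le> mark N u v"
  using assms unfolding wf_net_def by blast+

lemma mark_sym: "wf_net N \<Longrightarrow> mark N u v = mark N v u"
  and cond_sym: "wf_net N \<Longrightarrow> cond N u v = cond N v u"
  by (simp_all add: wf_net_def)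

lemma cond_nonneg: "wf_net N \<Longrightarrow> 0 \<le> cond N u v"
  by (cases "adj N u v") (auto simp: wf_net_def)

lemma mark_nonneg: "wf_net N \<Longrightarrow> 0 \<le> mark N u v"
  by (cases "adj N u v") (auto simp: wf_net_def)

lemma cvert_nonneg: "wf_net N \<Longrightarrow> 0 \<le> cvert N u"
  by (simp add: cvert_def sum_nonneg cond_nonneg)

lemma trans_prob_nonneg: "wf_net N \<Longrightarrow> 0 \<le> trans_prob N u v"
  by (simp add: trans_prob_def cvert_nonneg cond_nonneg)

lemma sum_trans_prob: "cvert N u \<noteq> 0 \<Longrightarrow> (\<Sum>v\<in>nbrs N u. trans_prob N u v) = 1"
  by (simp add: trans_prob_def cvert_def flip: sum_divide_distrib)

text \<open>At a vertex of conductance 0 division by zero makes every transition probability 0, so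
  the total mass there is 0 rather than 1.\<close>

lemma sum_trans_prob_le: "(\<Sum>v\<in>nbrs N u. trans_prob N u v) \<le> 1"
  by (cases "cvert N u = 0") (simp_all add: sum_trans_prob, simp add: trans_prob_def)

section \<open>The weighted distance and its Lipschitz property\<close>

lemma path_between_exists:
  assumes "wf_net N" "x \<in> verts N" "y \<in> verts N"
  shows "\<exists>xs. is_path N xs \<and> hd xs = x \<and> last xs = y"
proof -
  have "(x, y) \<in> {(x, y). adj N x y}\<^sup>*" using assms by (simp add: wf_net_def)
  then show ?thesis
  proof (induction rule: converse_rtrancl_induct)
    case base
    show ?case by (rule exI[of _ "[y]"]) (simp add: is_path_def)
  next
    case (step x w)
    then obtain xs where xs: "is_path N xs" "hd xs = w" "last xs = y" by blast
    then have "xs \<noteq> []" by (auto simp: is_path_def)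
    with xs step(1) show ?case
      by (intro exI[of _ "x # xs"]) (simp add: is_path_Cons)
  qed
qed

lemma path_weight_nonneg: "wf_net N \<Longrightarrow> 0 \<le> path_weight N xs"
  by (simp add: path_weight_def sum_nonneg mark_nonneg)

lemma edist_eq_wdist:
  assumes "wf_net N" "x \<in> verts N" "y \<in> verts N"
  shows "edist N x y = ennreal (wdist N x y)"
proof -
  define S where "S = {path_weight N xs | xs. is_path N xs \<and> hd xs = x \<and> last xs = y}"
  have ne: "S \<noteq> {}" using path_between_exists[OF assms] by (auto simp: S_def)
  have bdd: "bdd_below S" and pos: "\<And>w. w \<in> S \<Longrightarrow> 0 \<le> w"
    using path_weight_nonneg[OF assms(1)] by (auto simp: S_def intro: bdd_belowI[of _ 0])
  show ?thesis
  proof (rule antisym)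
    show "ennreal (wdist N x y) \<le> edist N x y"
      unfolding edist_def wdist_def S_def[symmetric]
      using cInf_lower[OF _ bdd] by (intro INF_greatest) (auto simp: S_def intro!: ennreal_leI)
    show "edist N x y \<le> ennreal (wdist N x y)"
    proof (rule ennreal_le_epsilon)
      fix e :: real assume "0 < e"
      then obtain w where w: "w \<in> S" "w < wdist N x y + e"
        using cInf_lessD[OF ne, of "wdist N x y + e"] by (auto simp: wdist_def S_def)
      then obtain xs where xs: "is_path N xs" "hd xs = x" "last xs = y" "w = path_weight N xs"
        by (auto simp: S_def)
      have "edist N x y \<le> ennreal w"
        unfolding edist_def by (rule INF_lower2[of xs]) (use xs in auto)
      also have "\<dots> \<le> ennreal (wdist N x y + e)" using w by (intro ennreal_leI) simp
      also have "\<dots> = ennreal (wdist N x y) + ennreal e"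
        using \<open>0 < e\<close> cInf_greatest[OF ne pos] by (simp add: wdist_def S_def)
      finally show "edist N x y \<le> ennreal (wdist N x y) + ennreal e" .
    qed
  qed
qed

lemma wdist_nonneg:
  assumes "wf_net N" "x \<in> verts N" "y \<in> verts N"
  shows "0 \<le> wdist N x y"
  unfolding wdist_def using path_between_exists[OF assms] path_weight_nonneg[OF assms(1)]
  by (intro cInf_greatest) auto

lemma rdist_eq_wdist:
  assumes "wf_net N" "x \<in> verts N" "y \<in> verts N"
  shows "rdist N x y = wdist N x y"
  using assms by (simp add: rdist_def edist_eq_wdist wdist_nonneg)

lemma is_path_snoc:
  assumes "xs \<noteq> []"
  shows "is_path N (xs @ [v]) \<longleftrightarrow> is_path N xs \<and> adj N (last xs) v"
  using assms
proof (induction xs)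
  case (Cons a xs)
  then show ?case by (cases "xs = []") (auto simp: is_path_Cons, simp_all add: is_path_def)
qed simp

lemma path_weight_snoc:
  assumes "xs \<noteq> []"
  shows "path_weight N (xs @ [v]) = path_weight N xs + mark N (last xs) v"
proof -
  obtain n where n: "length xs = Suc n" using assms by (cases xs) auto
  then show ?thesis using assms
    by (auto simp: path_weight_def nth_append last_conv_nth intro!: sum.cong)
qed

lemma wdist_adj_le:
  assumes wf: "wf_net N" and z: "z \<in> verts N" and uv: "adj N u v"
  shows "wdist N z v \<le> wdist N z u + mark N u v"
proof -
  have "wdist N z v - mark N u v \<le> wdist N z u"
    unfolding wdist_def[of N z u]
  proof (rule cInf_greatest)
    show "{path_weight N xs |xs. is_path N xs \<and> hd xs = z \<and> last xs = u} \<noteq> {}"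
      using path_between_exists[OF wf z] wf_net_adj(2)[OF wf uv] by auto
    fix w assume "w \<in> {path_weight N xs |xs. is_path N xs \<and> hd xs = z \<and> last xs = u}"
    then obtain xs where xs: "is_path N xs" "hd xs = z" "last xs = u" "w = path_weight N xs" by blast
    then have "xs \<noteq> []" by (auto simp: is_path_def)
    then have "is_path N (xs @ [v])" "hd (xs @ [v]) = z" "last (xs @ [v]) = v"
      using xs uv by (auto simp: is_path_snoc)
    then have "wdist N z v \<le> path_weight N (xs @ [v])"
      unfolding wdist_def using path_weight_nonneg[OF wf]
      by (intro cInf_lower bdd_belowI[of _ 0]) auto
    then show "wdist N z v - mark N u v \<le> w"
      using xs \<open>xs \<noteq> []\<close> by (simp add: path_weight_snoc)
  qed
  then show ?thesis by simp
qed

lemma rdist_lipschitz: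
  assumes "wf_net N" "z \<in> verts N" "adj N u v"
  shows "\<bar>rdist N z v - rdist N z u\<bar> \<le> mark N u v"
proof -
  have *: "rdist N z v \<le> rdist N z u + mark N u v" if "adj N u v" for u v
    using wdist_adj_le[OF assms(1,2) that] wf_net_adj[OF assms(1) that] assms
    by (simp add: rdist_eq_wdist)
  have "adj N v u" "mark N v u = mark N u v"
    using assms wf_net_adj(1) mark_sym by blast+
  with *[OF assms(3)] *[of v u] show ?thesis by auto
qed

lemma rdist_self: "rdist N z z = 0"
proof -
  have "edist N z z \<le> 0"
    unfolding edist_def by (rule INF_lower2[of "[z]"]) (auto simp: is_path_def path_weight_def)
  then show ?thesis by (simp add: rdist_def)
qed

section \<open>Martingales of the distance functions\<close>

definition energy :: "net \<Rightarrow> nat \<Rightarrow> real" where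
  "energy N u = (\<Sum>v\<in>nbrs N u. trans_prob N u v * (mark N u v)\<^sup>2)"

text \<open>The generator of the walk applied to the distance from \<open>z\<close>. Subtracting it
  in \<open>incr\<close> makes \<open>mart\<close> the martingale part of the Doob decomposition of
  that distance along the walk.\<close>

definition drift :: "net \<Rightarrow> nat \<Rightarrow> nat \<Rightarrow> real" where
  "drift N z u = (\<Sum>v\<in>nbrs N u. trans_prob N u v * (rdist N z v - rdist N z u))"

definition incr :: "net \<Rightarrow> nat \<Rightarrow> nat \<Rightarrow> nat \<Rightarrow> real" where
  "incr N z u v = rdist N z v - rdist N z u - drift N z u"

definition mart :: "net \<Rightarrow> nat \<Rightarrow> nat list \<Rightarrow> nat \<Rightarrow> real" where
  "mart N z xs t = (\<Sum>i<t. incr N z (xs ! i) (xs ! Suc i))"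

lemma energy_nonneg: "wf_net N \<Longrightarrow> 0 \<le> energy N u"
  by (simp add: energy_def sum_nonneg trans_prob_nonneg)

text \<open>Jensen's inequality, from the nonnegativity of a variance with weights of total mass at
  most 1, followed by the Lipschitz bound. The right side is free of \<open>z\<close>, so one energy
  serves all base points.\<close>

lemma drift_sq_le_energy:
  assumes "wf_net N" "z \<in> verts N"
  shows "(drift N z u)\<^sup>2 \<le> energy N u"
proof -
  let ?p = "trans_prob N u" and ?x = "\<lambda>v. rdist N z v - rdist N z u" and ?s = "drift N z u"
  have "0 \<le> (\<Sum>v\<in>nbrs N u. ?p v * (?x v - ?s)\<^sup>2)"
    using assms by (intro sum_nonneg mult_nonneg_nonneg trans_prob_nonneg) auto
  also have "\<dots> = (\<Sum>v\<in>nbrs N u. ?p v * (?x v)\<^sup>2 - 2 * ?s * (?p v * ?x v) + ?s\<^sup>2 * ?p v)"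
    by (intro sum.cong) (auto simp: power2_eq_square algebra_simps)
  also have "\<dots> = (\<Sum>v\<in>nbrs N u. ?p v * (?x v)\<^sup>2) - 2 * ?s * ?s + ?s\<^sup>2 * (\<Sum>v\<in>nbrs N u. ?p v)"
    by (simp add: sum.distrib sum_subtractf drift_def flip: sum_distrib_left)
  also have "\<dots> \<le> (\<Sum>v\<in>nbrs N u. ?p v * (?x v)\<^sup>2) - 2 * ?s * ?s + ?s\<^sup>2 * 1"
    by (intro add_left_mono mult_left_mono sum_trans_prob_le) auto
  finally have "?s\<^sup>2 \<le> (\<Sum>v\<in>nbrs N u. ?p v * (?x v)\<^sup>2)"
    by (simp add: power2_eq_square)
  also have "\<dots> \<le> energy N u"
    unfolding energy_def
  proof (intro sum_mono mult_left_mono trans_prob_nonneg assms)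
    fix v assume "v \<in> nbrs N u"
    then have "\<bar>?x v\<bar> \<le> \<bar>mark N u v\<bar>"
      using rdist_lipschitz[OF assms, of u v] by (simp add: nbrs_def)
    then show "(?x v)\<^sup>2 \<le> (mark N u v)\<^sup>2" by (simp add: abs_le_square_iff)
  qed
  finally show ?thesis .
qed

lemma sum_trans_prob_incr:
  assumes "wf_net N"
  shows "(\<Sum>v\<in>nbrs N u. trans_prob N u v * incr N z u v) = 0"
proof (cases "cvert N u = 0")
  case False
  have "(\<Sum>v\<in>nbrs N u. trans_prob N u v * incr N z u v) =
      drift N z u - drift N z u * (\<Sum>v\<in>nbrs N u. trans_prob N u v)"
    by (simp add: incr_def right_diff_distrib[of _ _ "drift N z u"] sum_subtractf
        sum_distrib_right mult.commute[of "drift N z u"] flip: drift_def)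
  then show ?thesis using False by (simp add: sum_trans_prob)
qed (simp add: trans_prob_def)

text \<open>Up to a constant it dominates the expected quadratic variation of
  \<open>mart N z\<close> for every vertex \<open>z\<close> at once.\<close>

definition cum_energy :: "net \<Rightarrow> nat \<Rightarrow> nat \<Rightarrow> ennreal" where
  "cum_energy N n u = (\<Sum>i<n. walk_expect N i u (\<lambda>xs. ennreal (energy N (last xs))))"

lemma cum_energy_Suc:
  "cum_energy N (Suc n) u =
     ennreal (energy N u) + (\<Sum>v\<in>nbrs N u. ennreal (trans_prob N u v) * cum_energy N n v)"
proof -
  have "walk_expect N i v (\<lambda>xs. ennreal (energy N (last (u # xs)))) =
      walk_expect N i v (\<lambda>xs. ennreal (energy N (last xs)))" for i v
    by (rule walk_expect_cong) auto
  then show ?thesis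
    by (simp add: cum_energy_def sum.lessThan_Suc_shift sum_distrib_left sum.swap[of _ "{..<n}"]
        del: sum.lessThan_Suc last.simps) simp
qed

lemma sum_ennreal_trans_prob_le: "wf_net N \<Longrightarrow> (\<Sum>v\<in>nbrs N u. ennreal (trans_prob N u v)) \<le> 1"
  using sum_trans_prob_le[of N u] by (simp add: trans_prob_nonneg sum_nonneg ennreal_le_1)

text \<open>The potential of a vector-valued martingale grows in one step by at most its second-order
  Taylor term, since the first-order term averages out.\<close>

lemma walk_expect_potential_le:
  fixes \<xi> :: "'a \<Rightarrow> nat \<Rightarrow> nat \<Rightarrow> nat \<Rightarrow> real"
  assumes wf: "wf_net N" and fin: "finite I" and card: "real (card I) \<le> 2 ^ (m - 1)" and m: "m \<ge> 1"
    and centred: "\<And>a i u. a \<in> I \<Longrightarrow> (\<Sum>v\<in>nbrs N u. trans_prob N u v * \<xi> a i u v) = 0"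
    and bound: "\<And>a i u v. a \<in> I \<Longrightarrow> v \<in> nbrs N u \<Longrightarrow> \<bar>\<xi> a i u v\<bar> \<le> b u v"
    and var: "\<And>u. (\<Sum>v\<in>nbrs N u. trans_prob N u v * (b u v)\<^sup>2) \<le> 4 * energy N u"
  shows "walk_expect N n u (\<lambda>xs. ennreal (potential I m (\<lambda>a. x a + (\<Sum>i<n. \<xi> a i (xs ! i) (xs ! Suc i))))) \<le>
    ennreal (potential I m x) + ennreal (24 * real m) * cum_energy N n u"
  using centred bound
proof (induction n arbitrary: u x \<xi>)
  case 0
  show ?case by (simp add: cum_energy_def)
next
  case (Suc n)
  \<comment> \<open>After the first step the claim is applied again from the displaced vector, with
    the times of \<open>\<xi>\<close> shifted by one; hence the induction generalises over
    both.\<close>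
  define x' where "x' v a = x a + \<xi> a 0 u v" for v a
  let ?K = "3 * (2 * real m - 1)"
  let ?p = "trans_prob N u"
  \<comment> \<open>The 24 m absorbs the Taylor constant 3 (2 m - 1) multiplied by the 4 of the
    variance bound.\<close>
  have K: "0 \<le> ?K" "?K * 4 \<le> 24 * real m" using m by auto
  have IH: "walk_expect N n v (\<lambda>xs. ennreal (potential I m (\<lambda>a. x a +
        (\<Sum>i<Suc n. \<xi> a i ((u # xs) ! i) ((u # xs) ! Suc i))))) \<le>
      ennreal (potential I m (x' v)) + ennreal (24 * real m) * cum_energy N n v" for v
  proof -
    have "walk_expect N n v (\<lambda>xs. ennreal (potential I m (\<lambda>a. x a +
        (\<Sum>i<Suc n. \<xi> a i ((u # xs) ! i) ((u # xs) ! Suc i))))) =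
      walk_expect N n v (\<lambda>xs. ennreal (potential I m (\<lambda>a. x' v a + (\<Sum>i<n. \<xi> a (Suc i) (xs ! i) (xs ! Suc i)))))"
    proof (rule walk_expect_cong)
      fix xs assume "length xs = Suc n" "hd xs = v"
      then have "xs ! 0 = v" by (cases xs) auto
      then show "ennreal (potential I m (\<lambda>a. x a + (\<Sum>i<Suc n. \<xi> a i ((u # xs) ! i) ((u # xs) ! Suc i)))) =
        ennreal (potential I m (\<lambda>a. x' v a + (\<Sum>i<n. \<xi> a (Suc i) (xs ! i) (xs ! Suc i))))"
        by (simp add: sum.lessThan_Suc_shift x'_def add.assoc del: sum.lessThan_Suc)
    qed
    also have "\<dots> \<le> ennreal (potential I m (x' v)) + ennreal (24 * real m) * cum_energy N n v"
      by (rule Suc.IH[where \<xi> = "\<lambda>a i. \<xi> a (Suc i)"]) (use Suc.prems in auto)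
    finally show ?thesis .
  qed
  have step: "(\<Sum>v\<in>nbrs N u. ?p v * potential I m (x' v)) \<le> potential I m x + 24 * real m * energy N u"
  proof -
    define B where "B = (1 + (\<Sum>a\<in>I. x a ^ (2 * m))) powr (1 / real m - 1) * 2"
    have "(\<Sum>v\<in>nbrs N u. ?p v * potential I m (x' v)) \<le>
       (\<Sum>v\<in>nbrs N u. ?p v * (potential I m x + B * (\<Sum>a\<in>I. x a ^ (2 * m - 1) * \<xi> a 0 u v) + ?K * (b u v)\<^sup>2))"
      unfolding x'_def B_def using wf Suc.prems(2)
      by (intro sum_mono mult_left_mono potential_add_le fin card m trans_prob_nonneg)
    also have "\<dots> = potential I m x * (\<Sum>v\<in>nbrs N u. ?p v) +
        B * (\<Sum>v\<in>nbrs N u. \<Sum>a\<in>I. x a ^ (2 * m - 1) * (?p v * \<xi> a 0 u v)) +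
        ?K * (\<Sum>v\<in>nbrs N u. ?p v * (b u v)\<^sup>2)"
      by (simp only: distrib_left sum.distrib sum_distrib_left mult_ac)
    also have "(\<Sum>v\<in>nbrs N u. \<Sum>a\<in>I. x a ^ (2 * m - 1) * (?p v * \<xi> a 0 u v)) = 0"
      by (subst sum.swap) (simp add: Suc.prems(1) flip: sum_distrib_left)
    also have "potential I m x * (\<Sum>v\<in>nbrs N u. ?p v) + B * 0 + ?K * (\<Sum>v\<in>nbrs N u. ?p v * (b u v)\<^sup>2) \<le>
        potential I m x * 1 + B * 0 + ?K * (4 * energy N u)"
      by (intro add_mono mult_left_mono sum_trans_prob_le potential_nonneg K var order.refl)
    also have "\<dots> \<le> potential I m x + 24 * real m * energy N u"
      using mult_right_mono[OF K(2) energy_nonneg[OF wf, of u]] by (simp add: mult_ac)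
    finally show ?thesis .
  qed
  have "walk_expect N (Suc n) u (\<lambda>xs. ennreal (potential I m (\<lambda>a. x a + (\<Sum>i<Suc n. \<xi> a i (xs ! i) (xs ! Suc i))))) \<le>
      (\<Sum>v\<in>nbrs N u. ennreal (?p v) * (ennreal (potential I m (x' v)) + ennreal (24 * real m) * cum_energy N n v))"
    by (subst walk_expect.simps) (intro sum_mono mult_left_mono IH zero_le)
  also have "\<dots> = ennreal (\<Sum>v\<in>nbrs N u. ?p v * potential I m (x' v)) +
      ennreal (24 * real m) * (\<Sum>v\<in>nbrs N u. ennreal (?p v) * cum_energy N n v)"
    by (simp add: distrib_left sum.distrib sum_distrib_left mult_ac potential_nonneg
        trans_prob_nonneg[OF wf] ennreal_mult flip: sum_ennreal)
  also have "\<dots> \<le> ennreal (potential I m x + 24 * real m * energy N u) +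
      ennreal (24 * real m) * (\<Sum>v\<in>nbrs N u. ennreal (?p v) * cum_energy N n v)"
    by (intro add_right_mono ennreal_leI step)
  also have "\<dots> = ennreal (potential I m x) + ennreal (24 * real m) * cum_energy N (Suc n) u"
    by (simp add: cum_energy_Suc distrib_left potential_nonneg energy_nonneg[OF wf] ennreal_mult add.assoc)
  finally show ?case .
qed

text \<open>Pairs of a base point and a time are coordinates of one vector martingale. The maximum
  over times is thus treated like the maximum over base points, in place of Doob's inequality, and
  only multiplies the dimension by n + 1. The base point may depend on the whole walk; the
  alternative \<open>\<Psi> xs \<le> 0\<close> is for truncated walks.\<close>

lemma walk_expect_mart_sq_le:
  assumes wf: "wf_net N" and S: "finite S" "S \<subseteq> verts N"
    and card: "real (card S) * (real n + 1) \<le> 2 ^ (m - 1)" and m: "m \<ge> 1"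
    and \<Psi>: "\<And>xs. length xs = Suc n \<Longrightarrow> hd xs = u \<Longrightarrow> is_path N xs \<Longrightarrow>
      \<Psi> xs \<le> 0 \<or> (\<exists>z\<in>S. \<exists>t\<le>n. \<Psi> xs \<le> (mart N z xs t)\<^sup>2)"
  shows "walk_expect N n u (\<lambda>xs. ennreal (\<Psi> xs)) \<le> 1 + ennreal (24 * real m) * cum_energy N n u"
proof -
  define I where "I = S \<times> {..n}"
  \<comment> \<open>Coordinate (z, t) follows the martingale based at \<open>z\<close> and freezes
    at time t, so its final value is \<open>mart N z xs t\<close>.\<close>
  define \<xi> where "\<xi> a i u v = (if i < snd a then incr N (fst a) u v else 0)" for a :: "nat \<times> nat" and i u v
  \<comment> \<open>The Lipschitz bound for the increment plus the bound for its drift. Squaring a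
    sum of two terms and averaging gives the factor 4 of energy.\<close>
  define b where "b u v = mark N u v + sqrt (energy N u)" for u v
  have fin: "finite I" using S by (simp add: I_def)
  have 1: "(\<Sum>v\<in>nbrs N u. trans_prob N u v * \<xi> a i u v) = 0" for a i u
    using sum_trans_prob_incr[OF wf, of u "fst a"] by (cases "i < snd a") (simp_all add: \<xi>_def)
  have 2: "\<bar>\<xi> a i u v\<bar> \<le> b u v" if "a \<in> I" "v \<in> nbrs N u" for a i u v
  proof -
    have z: "fst a \<in> verts N" using that S by (auto simp: I_def)
    have "\<bar>rdist N (fst a) v - rdist N (fst a) u\<bar> \<le> mark N u v"
      using that by (intro rdist_lipschitz wf z) (simp add: nbrs_def)
    moreover have "\<bar>drift N (fst a) u\<bar> \<le> sqrt (energy N u)"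
      using drift_sq_le_energy[OF wf z, of u] by (simp add: real_le_rsqrt)
    moreover have "0 \<le> b u v" by (simp add: b_def mark_nonneg energy_nonneg wf)
    ultimately show ?thesis by (auto simp: \<xi>_def incr_def b_def)
  qed
  have 3: "(\<Sum>v\<in>nbrs N u. trans_prob N u v * (b u v)\<^sup>2) \<le> 4 * energy N u" for u
  proof -
    have "(b u v)\<^sup>2 \<le> 2 * (mark N u v)\<^sup>2 + 2 * energy N u" for v
      using energy_nonneg[OF wf, of u] sum_squares_bound[of "mark N u v" "sqrt (energy N u)"]
      by (simp add: b_def power2_sum)
    then have "(\<Sum>v\<in>nbrs N u. trans_prob N u v * (b u v)\<^sup>2) \<le>
        (\<Sum>v\<in>nbrs N u. trans_prob N u v * (2 * (mark N u v)\<^sup>2 + 2 * energy N u))"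
      by (intro sum_mono mult_left_mono trans_prob_nonneg wf)
    also have "\<dots> = 2 * (\<Sum>v\<in>nbrs N u. trans_prob N u v * (mark N u v)\<^sup>2) +
        2 * energy N u * (\<Sum>v\<in>nbrs N u. trans_prob N u v)"
      by (simp add: distrib_left sum.distrib sum_distrib_left mult_ac)
    also have "(\<Sum>v\<in>nbrs N u. trans_prob N u v * (mark N u v)\<^sup>2) = energy N u"
      by (simp add: energy_def)
    also have "2 * energy N u + 2 * energy N u * (\<Sum>v\<in>nbrs N u. trans_prob N u v) \<le> 2 * energy N u + 2 * energy N u * 1"
      using energy_nonneg[OF wf, of u] by (intro add_left_mono mult_left_mono sum_trans_prob_le) auto
    finally show ?thesis by simp
  qed
  have "walk_expect N n u (\<lambda>xs. ennreal (\<Psi> xs)) \<le>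
      walk_expect N n u (\<lambda>xs. ennreal (potential I m (\<lambda>a. 0 + (\<Sum>i<n. \<xi> a i (xs ! i) (xs ! Suc i)))))"
  proof (intro walk_expect_mono ennreal_leI)
    fix xs :: "nat list" assume "length xs = Suc n" "hd xs = u" "is_path N xs"
    from \<Psi>[OF this] show "\<Psi> xs \<le> potential I m (\<lambda>a. 0 + (\<Sum>i<n. \<xi> a i (xs ! i) (xs ! Suc i)))"
    proof (elim disjE bexE exE conjE)
      fix z t assume zt: "z \<in> S" "t \<le> n" "\<Psi> xs \<le> (mart N z xs t)\<^sup>2"
      have "mart N z xs t = (\<Sum>i<n. \<xi> (z, t) i (xs ! i) (xs ! Suc i))"
        unfolding mart_def \<xi>_def using zt(2) by (intro sum.mono_neutral_cong_left) auto
      then show ?thesis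
        using zt square_le_potential[OF fin, of "(z, t)" m "\<lambda>a. 0 + (\<Sum>i<n. \<xi> a i (xs ! i) (xs ! Suc i))"] m
        by (auto simp: I_def)
    qed (use potential_nonneg order_trans in blast)
  qed
  also have "\<dots> \<le> ennreal (potential I m (\<lambda>_. 0)) + ennreal (24 * real m) * cum_energy N n u"
    by (rule walk_expect_potential_le[OF wf fin _ m 1 2 3]) (use card in \<open>simp_all add: I_def card_cartesian_product algebra_simps\<close>)
  finally show ?thesis using m by (simp add: potential_zero)
qed

lemma walk_expect_const_le:
  assumes "wf_net N"
  shows "walk_expect N n u (\<lambda>_. c) \<le> c"
proof (induction n arbitrary: u)
  case (Suc n)
  have "walk_expect N (Suc n) u (\<lambda>_. c) \<le> (\<Sum>v\<in>nbrs N u. ennreal (trans_prob N u v) * c)"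
    by (auto intro!: sum_mono mult_left_mono Suc)
  also have "\<dots> = (\<Sum>v\<in>nbrs N u. ennreal (trans_prob N u v)) * c"
    by (simp add: sum_distrib_right)
  also have "\<dots> \<le> 1 * c"
    by (rule mult_right_mono[OF sum_ennreal_trans_prob_le[OF assms]]) simp
  finally show ?case by simp
qed simp

lemma walk_expect_sum_energy_le:
  assumes "wf_net N"
  shows "walk_expect N n u (\<lambda>xs. \<Sum>i\<le>n. ennreal (energy N (xs ! i))) \<le> cum_energy N (Suc n) u"
proof (induction n arbitrary: u)
  case 0
  show ?case by (simp add: cum_energy_def)
next
  case (Suc n)
  have "walk_expect N (Suc n) u (\<lambda>xs. \<Sum>i\<le>Suc n. ennreal (energy N (xs ! i))) =
      walk_expect N (Suc n) u (\<lambda>_. ennreal (energy N u)) + (\<Sum>v\<in>nbrs N u. ennreal (trans_prob N u v) *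
        walk_expect N n v (\<lambda>xs. \<Sum>i\<le>n. ennreal (energy N (xs ! i))))"
    by (simp add: sum.atMost_Suc_shift walk_expect_add distrib_left sum.distrib del: sum.atMost_Suc)
  also have "\<dots> \<le> ennreal (energy N u) + (\<Sum>v\<in>nbrs N u. ennreal (trans_prob N u v) * cum_energy N (Suc n) v)"
    by (intro add_mono sum_mono mult_left_mono Suc walk_expect_const_le assms) auto
  also have "\<dots> = cum_energy N (Suc (Suc n)) u"
    by (rule cum_energy_Suc[symmetric])
  finally show ?case .
qed

section \<open>The Lyons-Zheng decomposition along a path\<close>

definition back_mart :: "net \<Rightarrow> nat \<Rightarrow> nat list \<Rightarrow> nat \<Rightarrow> real" where
  "back_mart N z xs t = (\<Sum>i<t. incr N z (xs ! Suc i) (xs ! i))"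

text \<open>Forward and backward increments over one edge differ by twice the change of the distance
  plus the difference of the drifts at its ends. The drifts therefore telescope and leave two
  boundary terms instead of a sum over time.\<close>

lemma mart_minus_back_mart:
  "mart N z xs t - back_mart N z xs t =
     2 * (rdist N z (xs ! t) - rdist N z (xs ! 0)) + drift N z (xs ! t) - drift N z (xs ! 0)"
  by (induction t) (simp_all add: mart_def back_mart_def incr_def)

text \<open>The first t steps traversed backwards are the last t steps of the reversed path, which
  makes this a difference of two values of the reversed martingale.\<close>

lemma back_mart_eq:
  assumes "length xs = Suc n" "t \<le> n"
  shows "back_mart N z xs t = mart N z (rev xs) n - mart N z (rev xs) (n - t)"
  using assms(2)
proof (induction t)
  case (Suc t)
  have "n - t = Suc (n - Suc t)" using Suc.prems by simp
  then have "mart N z (rev xs) (n - t) = mart N z (rev xs) (n - Suc t) +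
      incr N z (rev xs ! (n - Suc t)) (rev xs ! (n - t))"
    by (simp add: mart_def)
  moreover have "rev xs ! (n - Suc t) = xs ! Suc t" "rev xs ! (n - t) = xs ! t"
    using Suc.prems assms(1) by (simp_all add: rev_nth)
  ultimately show ?case using Suc by (simp add: back_mart_def)
qed (simp add: back_mart_def)

definition mart_max :: "net \<Rightarrow> nat \<Rightarrow> nat \<Rightarrow> nat list \<Rightarrow> real" where
  "mart_max N z n xs = Max ((\<lambda>t. (mart N z xs t)\<^sup>2) ` {..n})"

lemma mart_max_ge: "t \<le> n \<Longrightarrow> (mart N z xs t)\<^sup>2 \<le> mart_max N z n xs"
  by (auto simp: mart_max_def intro!: Max_ge)

lemma mart_max_nonneg: "0 \<le> mart_max N z n xs"
  by (rule order_trans[OF _ mart_max_ge[of 0]]) auto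

lemma mart_max_attained: "\<exists>t\<le>n. mart_max N z n xs = (mart N z xs t)\<^sup>2"
proof -
  have "mart_max N z n xs \<in> (\<lambda>t. (mart N z xs t)\<^sup>2) ` {..n}"
    unfolding mart_max_def by (rule Max_in) auto
  then show ?thesis by auto
qed

lemma sq_diff_le: "(a - b)\<^sup>2 \<le> 2 * a\<^sup>2 + 2 * (b::real)\<^sup>2"
  using zero_le_power2[of "a + b"] by (simp add: power2_eq_square algebra_simps)

lemma rdist_sq_le:
  assumes wf: "wf_net N" and z: "hd xs \<in> verts N" and len: "length xs = Suc n" and t: "t \<le> n"
  shows "(rdist N (hd xs) (xs ! t))\<^sup>2 \<le> mart_max N (hd xs) n xs + 4 * mart_max N (hd xs) n (rev xs) +
    2 * (\<Sum>i\<le>n. energy N (xs ! i))"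
proof -
  let ?z = "hd xs"
  have ne: "xs \<noteq> []" using len by auto
  then have z0: "xs ! 0 = ?z" by (simp add: hd_conv_nth)
  have e: "energy N (xs ! i) \<le> (\<Sum>i\<le>n. energy N (xs ! i))" if "i \<le> n" for i
    using that energy_nonneg[OF wf] by (intro member_le_sum) auto
  define a b c d where "a = mart N ?z xs t" and "b = back_mart N ?z xs t"
    and "c = drift N ?z (xs ! t)" and "d = drift N ?z (xs ! 0)"
  have "2 * rdist N ?z (xs ! t) = (a - b) - (c - d)"
    using mart_minus_back_mart[of N ?z xs t] rdist_self[of N ?z] z0 by (simp add: a_def b_def c_def d_def)
  then have "4 * (rdist N ?z (xs ! t))\<^sup>2 = ((a - b) - (c - d))\<^sup>2"
    by (metis power2_eq_square four_x_squared)
  \<comment> \<open>Twice the distance is a combination of four terms. Splitting the square in two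
    stages costs 4, which cancels the 4 on the left.\<close>
  also have "\<dots> \<le> 4 * (a\<^sup>2 + b\<^sup>2 + c\<^sup>2 + d\<^sup>2)"
    using sq_diff_le[of "a - b" "c - d"] sq_diff_le[of a b] sq_diff_le[of c d] by simp
  finally have 1: "(rdist N ?z (xs ! t))\<^sup>2 \<le> a\<^sup>2 + b\<^sup>2 + c\<^sup>2 + d\<^sup>2" by simp
  have "b\<^sup>2 \<le> 2 * (mart N ?z (rev xs) n)\<^sup>2 + 2 * (mart N ?z (rev xs) (n - t))\<^sup>2"
    unfolding b_def back_mart_eq[OF len t] by (rule sq_diff_le)
  also have "\<dots> \<le> 2 * mart_max N (hd xs) n (rev xs) + 2 * mart_max N (hd xs) n (rev xs)"
    using mart_max_ge[of n n N ?z "rev xs"] mart_max_ge[of "n - t" n N ?z "rev xs"] by simp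
  finally have 2: "b\<^sup>2 \<le> 4 * mart_max N (hd xs) n (rev xs)" by simp
  have 3: "a\<^sup>2 \<le> mart_max N (hd xs) n xs" unfolding a_def by (rule mart_max_ge[OF t])
  have 4: "c\<^sup>2 \<le> energy N (xs ! t)" "d\<^sup>2 \<le> energy N (xs ! 0)"
    unfolding c_def d_def using drift_sq_le_energy[OF wf z] by auto
  \<comment> \<open>Each of the two boundary drifts is charged to the whole sum of energies, which
    makes the bound uniform in t.\<close>
  show ?thesis using 1 2 3 4 e[OF t] e[of 0] by simp
qed

section \<open>Sums over trajectories and monotonicity in time\<close>

definition walks_from :: "net \<Rightarrow> nat \<Rightarrow> nat \<Rightarrow> nat list set" where
  "walks_from N u n = {xs. length xs = Suc n \<and> hd xs = u \<and> is_path N xs}"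

lemma walks_from_0: "walks_from N u 0 = {[u]}"
  by (auto simp: walks_from_def is_path_def length_Suc_conv)

lemma walks_from_Suc: "walks_from N u (Suc n) = (\<Union>v\<in>nbrs N u. (#) u ` walks_from N v n)"
proof (intro set_eqI iffI)
  fix xs assume "xs \<in> walks_from N u (Suc n)"
  then obtain ys where ys: "xs = u # ys" "length ys = Suc n" "is_path N (u # ys)"
    by (auto simp: walks_from_def length_Suc_conv)
  then have "ys \<noteq> []" by auto
  with ys show "xs \<in> (\<Union>v\<in>nbrs N u. (#) u ` walks_from N v n)"
    by (auto simp: is_path_Cons walks_from_def nbrs_def)
next
  fix xs assume "xs \<in> (\<Union>v\<in>nbrs N u. (#) u ` walks_from N v n)"
  then obtain ys where ys: "xs = u # ys" "adj N u (hd ys)" "length ys = Suc n" "is_path N ys"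
    by (auto simp: walks_from_def nbrs_def)
  then have "ys \<noteq> []" by auto
  with ys show "xs \<in> walks_from N u (Suc n)"
    by (auto simp: is_path_Cons walks_from_def)
qed

lemma finite_walks_from: "wf_net N \<Longrightarrow> finite (walks_from N u n)"
  by (induction n arbitrary: u) (simp_all add: walks_from_0 walks_from_Suc finite_nbrs)

lemma walk_prob_Cons:
  assumes "ys \<noteq> []"
  shows "walk_prob N (u # ys) = trans_prob N u (hd ys) * walk_prob N ys"
proof -
  obtain v zs where "ys = v # zs" using assms by (cases ys) auto
  then show ?thesis by (simp add: walk_prob_def prod.lessThan_Suc_shift del: prod.lessThan_Suc)
qed

lemma walk_prob_nonneg: "wf_net N \<Longrightarrow> 0 \<le> walk_prob N xs"
  by (simp add: walk_prob_def prod_nonneg trans_prob_nonneg)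

lemma walk_expect_eq_sum:
  assumes "wf_net N"
  shows "walk_expect N n u \<Phi> = (\<Sum>xs\<in>walks_from N u n. ennreal (walk_prob N xs) * \<Phi> xs)"
proof (induction n arbitrary: u \<Phi>)
  case 0
  show ?case by (simp add: walks_from_0 walk_prob_def)
next
  case (Suc n)
  have "(\<Sum>xs\<in>walks_from N u (Suc n). ennreal (walk_prob N xs) * \<Phi> xs) =
      (\<Sum>v\<in>nbrs N u. \<Sum>xs\<in>(#) u ` walks_from N v n. ennreal (walk_prob N xs) * \<Phi> xs)"
    unfolding walks_from_Suc using assms
    by (intro sum.UNION_disjoint) (auto simp: finite_nbrs finite_walks_from, auto simp: walks_from_def)
  also have "\<dots> = (\<Sum>v\<in>nbrs N u. \<Sum>xs\<in>walks_from N v n. ennreal (walk_prob N (u # xs)) * \<Phi> (u # xs))"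
    by (simp add: sum.reindex)
  also have "\<dots> = (\<Sum>v\<in>nbrs N u. \<Sum>xs\<in>walks_from N v n.
      ennreal (trans_prob N u v) * (ennreal (walk_prob N xs) * \<Phi> (u # xs)))"
  proof (intro sum.cong refl)
    fix v xs assume "xs \<in> walks_from N v n"
    then have "xs \<noteq> []" "hd xs = v" by (auto simp: walks_from_def)
    then show "ennreal (walk_prob N (u # xs)) * \<Phi> (u # xs) =
        ennreal (trans_prob N u v) * (ennreal (walk_prob N xs) * \<Phi> (u # xs))"
      using assms by (simp add: walk_prob_Cons ennreal_mult trans_prob_nonneg walk_prob_nonneg mult.assoc)
  qed
  also have "\<dots> = walk_expect N (Suc n) u \<Phi>"
    by (simp add: Suc sum_distrib_left)
  finally show ?case by simp
qed

text \<open>By symmetry the edge just crossed also counts towards the conductance of its far end, so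
  the walk never reaches a vertex where mass is lost.\<close>

lemma cvert_pos_of_trans_prob:
  assumes "wf_net N" "trans_prob N u v \<noteq> 0"
  shows "0 < cvert N v"
proof -
  have "adj N u v" using assms by (auto simp: trans_prob_def wf_net_def)
  then have uv: "u \<in> nbrs N v" using wf_net_adj(1)[OF assms(1)] by (simp add: nbrs_def)
  have "cond N v u \<noteq> 0" using assms cond_sym[OF assms(1), of u v] by (auto simp: trans_prob_def)
  then have "0 < cond N v u" using cond_nonneg[OF assms(1), of v u] by simp
  also have "\<dots> \<le> cvert N v"
    unfolding cvert_def using assms uv by (intro member_le_sum finite_nbrs cond_nonneg) auto
  finally show ?thesis .
qed

text \<open>Consistency of the laws of walks of different lengths. Positivity of the conductance
  propagates along steps of positive probability, so the last step has total mass exactly 1.\<close>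

lemma walk_expect_butlast:
  assumes wf: "wf_net N" and "0 < cvert N u"
  shows "walk_expect N (Suc n) u (\<lambda>xs. \<Phi> (butlast xs)) = walk_expect N n u \<Phi>"
  using assms(2)
proof (induction n arbitrary: u \<Phi>)
  case 0
  have "(\<Sum>v\<in>nbrs N u. ennreal (trans_prob N u v)) = 1"
    using 0 wf sum_trans_prob[of N u] by (simp add: trans_prob_nonneg)
  then show ?case by (simp flip: sum_distrib_right)
next
  case (Suc n)
  have "ennreal (trans_prob N u v) * walk_expect N (Suc n) v (\<lambda>xs. \<Phi> (butlast (u # xs))) =
      ennreal (trans_prob N u v) * walk_expect N n v (\<lambda>xs. \<Phi> (u # xs))" for v
  proof (cases "trans_prob N u v = 0")
    case False
    have "walk_expect N (Suc n) v (\<lambda>xs. \<Phi> (butlast (u # xs))) =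
        walk_expect N (Suc n) v (\<lambda>xs. \<Phi> (u # butlast xs))"
      by (rule walk_expect_cong) auto
    with Suc.IH[OF cvert_pos_of_trans_prob[OF wf False], of "\<lambda>xs. \<Phi> (u # xs)"] show ?thesis by simp
  qed simp
  then show ?case by (simp only: walk_expect.simps(2)[of N "Suc n" u] walk_expect.simps(2)[of N n u])
qed

definition max_sq :: "net \<Rightarrow> nat \<Rightarrow> nat list \<Rightarrow> real" where
  "max_sq N n xs = Max {(wdist N (root N) (xs ! t))\<^sup>2 | t. t \<le> n}"

lemma max_sq_alt: "max_sq N n xs = Max ((\<lambda>t. (wdist N (root N) (xs ! t))\<^sup>2) ` {..n})"
  unfolding max_sq_def by (rule arg_cong[where f = Max]) auto

lemma max_sq_nonneg: "0 \<le> max_sq N n xs"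
  unfolding max_sq_alt by (rule order_trans[OF _ Max_ge[where x = "(wdist N (root N) (xs ! 0))\<^sup>2"]]) auto

lemma quenched_max_sq_eq:
  assumes "wf_net N"
  shows "ennreal (quenched_max_sq N n) = walk_expect N n (root N) (\<lambda>xs. ennreal (max_sq N n xs))"
  using assms
  by (simp add: quenched_max_sq_def walk_expect_eq_sum walks_def walks_from_def max_sq_nonneg
      walk_prob_nonneg ennreal_mult flip: max_sq_def sum_ennreal)

lemma quenched_max_sq_nonneg: "wf_net N \<Longrightarrow> 0 \<le> quenched_max_sq N n"
  unfolding quenched_max_sq_def max_sq_def[symmetric]
  by (intro sum_nonneg mult_nonneg_nonneg walk_prob_nonneg max_sq_nonneg)

lemma quenched_max_sq_mono:
  assumes wf: "wf_net N" and pos: "0 < cvert N (root N)" and "n \<le> k"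
  shows "quenched_max_sq N n \<le> quenched_max_sq N k"
proof (rule lift_Suc_mono_le[OF _ assms(3)])
  fix n
  have "ennreal (quenched_max_sq N n) = walk_expect N (Suc n) (root N) (\<lambda>xs. ennreal (max_sq N n (butlast xs)))"
    using walk_expect_butlast[OF wf pos, of n "\<lambda>xs. ennreal (max_sq N n xs)"]
    by (simp only: quenched_max_sq_eq[OF wf])
  also have "\<dots> \<le> walk_expect N (Suc n) (root N) (\<lambda>xs. ennreal (max_sq N (Suc n) xs))"
  proof (intro walk_expect_mono ennreal_leI)
    fix xs :: "nat list" assume "length xs = Suc (Suc n)"
    then have "butlast xs ! t = xs ! t" if "t \<le> n" for t
      using that by (intro nth_butlast) simp
    then have "max_sq N n (butlast xs) = Max ((\<lambda>t. (wdist N (root N) (xs ! t))\<^sup>2) ` {..n})"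
      unfolding max_sq_alt by (intro arg_cong[where f = Max] image_cong) auto
    also have "\<dots> \<le> max_sq N (Suc n) xs"
      unfolding max_sq_alt by (rule Max_mono) auto
    finally show "max_sq N n (butlast xs) \<le> max_sq N (Suc n) xs" .
  qed
  also have "\<dots> = ennreal (quenched_max_sq N (Suc n))"
    by (rule quenched_max_sq_eq[OF wf, symmetric])
  finally show "quenched_max_sq N n \<le> quenched_max_sq N (Suc n)"
    using quenched_max_sq_nonneg[OF wf] by (simp add: ennreal_le_iff)
qed

section \<open>Graph balls and the vertices a walk can reach\<close>

lemma is_path_append:
  assumes "is_path N xs" "is_path N ys" "last xs = hd ys"
  shows "is_path N (xs @ tl ys)"
  using assms
proof (induction xs)
  case (Cons a xs)
  show ?case
  proof (cases "xs = []")
    case True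
    with Cons.prems have "a = hd ys" "ys \<noteq> []" by (auto simp: is_path_def)
    with True Cons.prems show ?thesis by simp
  next
    case False
    with Cons.prems Cons.IH show ?thesis by (simp add: is_path_Cons)
  qed
qed (simp add: is_path_def)

lemma ball_trans:
  assumes "v \<in> ball N u a" "w \<in> ball N v b"
  shows "w \<in> ball N u (a + b)"
proof -
  obtain xs where xs: "is_path N xs" "hd xs = u" "last xs = v" "real (length xs - 1) \<le> a"
    using assms by (auto simp: ball_def)
  obtain ys where ys: "is_path N ys" "hd ys = v" "last ys = w" "real (length ys - 1) \<le> b"
    using assms by (auto simp: ball_def)
  have ne: "xs \<noteq> []" "ys \<noteq> []" using xs ys by (auto simp: is_path_def)
  have "is_path N (xs @ tl ys)" using is_path_append xs ys by metis
  moreover have "hd (xs @ tl ys) = u" using ne xs by simp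
  moreover have "last (xs @ tl ys) = w"
    using ne xs ys by (cases ys) (auto simp: last_append)
  moreover have "real (length (xs @ tl ys) - 1) = real (length xs - 1) + real (length ys - 1)"
    using ne by (cases xs) auto
  ultimately show ?thesis
    using xs ys unfolding ball_def by (intro CollectI exI[of _ "xs @ tl ys"]) simp
qed

lemma is_path_rev:
  assumes "wf_net N" "is_path N xs"
  shows "is_path N (rev xs)"
  unfolding is_path_def
proof (intro conjI allI impI)
  show "rev xs \<noteq> []" using assms by (auto simp: is_path_def)
  fix i assume i: "i < length (rev xs) - 1"
  define j where "j = length xs - Suc (Suc i)"
  have "adj N (xs ! j) (xs ! Suc j)" using assms(2) i by (auto simp: is_path_def j_def)
  moreover have "rev xs ! i = xs ! Suc j" "rev xs ! Suc i = xs ! j"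
    using i by (simp_all add: rev_nth j_def Suc_diff_Suc)
  ultimately show "adj N (rev xs ! i) (rev xs ! Suc i)"
    using wf_net_adj(1)[OF assms(1)] by simp
qed

lemma walk_in_ball:
  assumes "is_path N xs" "length xs = Suc n"
  shows "last xs \<in> ball N (hd xs) (real n)"
  using assms by (auto simp: ball_def)

lemma finite_ball:
  assumes "wf_net N"
  shows "finite (ball N u R)"
proof (rule finite_subset)
  show "ball N u R \<subseteq> (\<Union>k\<in>{..nat \<lceil>R\<rceil>}. last ` walks_from N u k)"
  proof
    fix y assume "y \<in> ball N u R"
    then obtain xs where xs: "is_path N xs" "hd xs = u" "last xs = y" "real (length xs - 1) \<le> R"
      by (auto simp: ball_def)
    then have "length xs - 1 \<le> nat \<lceil>R\<rceil>" by linarith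
    moreover have "xs \<in> walks_from N u (length xs - 1)"
      using xs by (auto simp: walks_from_def is_path_def)
    ultimately show "y \<in> (\<Union>k\<in>{..nat \<lceil>R\<rceil>}. last ` walks_from N u k)"
      using xs by blast
  qed
qed (auto simp: finite_walks_from assms)

lemma path_in_verts:
  assumes wf: "wf_net N" and "is_path N xs" "hd xs \<in> verts N" "t < length xs"
  shows "xs ! t \<in> verts N"
proof (cases t)
  case 0
  then show ?thesis using assms by (simp add: hd_conv_nth)
next
  case (Suc s)
  then have "adj N (xs ! s) (xs ! t)" using assms by (auto simp: is_path_def)
  then show ?thesis using wf_net_adj(3)[OF wf] by blast
qed

lemma ball_subset_verts:
  assumes "wf_net N" "u \<in> verts N"
  shows "ball N u R \<subseteq> verts N"
proof
  fix y assume "y \<in> ball N u R"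
  then obtain xs where "is_path N xs" "hd xs = u" "y = xs ! (length xs - 1)" "xs \<noteq> []"
    by (auto simp: ball_def is_path_def last_conv_nth)
  then show "y \<in> verts N" using path_in_verts[OF assms(1)] assms(2) by auto
qed

text \<open>The length test makes this invariant under relabelling for lists of every length, since
  out-of-range indexing does not commute with \<open>map\<close>.\<close>

definition back_term :: "nat \<Rightarrow> real \<Rightarrow> net \<Rightarrow> nat list \<Rightarrow> ennreal" where
  "back_term n D N xs = (if length xs = Suc n \<and> 1 / D \<le> cvert N (hd xs) \<and> vol N (hd xs) (2 * real n) \<le> D
     then ennreal (mart_max N (hd xs) n (rev xs)) else 0)"

text \<open>After reversal the base point of the distance function is the endpoint of the walk, so the
  martingale has to be controlled for all base points simultaneously. Only base points of conductance
  at least \<open>1 / D\<close> matter, and the volume bound leaves at most \<open>D\<^sup>2\<close> of them.\<close>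

lemma walk_expect_back_term_le:
  assumes wf: "wf_net N" and u: "u \<in> verts N" and D: "0 < D"
    and card: "D\<^sup>2 * (real n + 1) \<le> 2 ^ (m - 1)" and m: "m \<ge> 1"
  shows "walk_expect N n u (\<lambda>xs. back_term n D N (rev xs)) \<le> 1 + ennreal (24 * real m) * cum_energy N n u"
proof -
  \<comment> \<open>The candidate set may depend on the starting vertex only, not on the walk. It is
    emptied when the ball around \<open>u\<close> is too large, so that its cardinality bound is
    unconditional.\<close>
  define S where "S = (if vol N u (real n) \<le> D then {z \<in> ball N u (real n). 1 / D \<le> cvert N z} else {})"
  define \<Psi> where "\<Psi> xs = (if 1 / D \<le> cvert N (last xs) \<and> vol N (last xs) (2 * real n) \<le> D
     then mart_max N (last xs) n xs else 0)" for xs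
  have "walk_expect N n u (\<lambda>xs. back_term n D N (rev xs)) = walk_expect N n u (\<lambda>xs. ennreal (\<Psi> xs))"
    by (rule walk_expect_cong) (simp add: back_term_def \<Psi>_def hd_rev)
  also have "\<dots> \<le> 1 + ennreal (24 * real m) * cum_energy N n u"
  proof (rule walk_expect_mart_sq_le[OF wf, of S])
    show "finite S" using finite_ball[OF wf] by (simp add: S_def)
    show "S \<subseteq> verts N" using ball_subset_verts[OF wf u] by (auto simp: S_def)
    have "real (card S) \<le> D\<^sup>2"
    proof (cases "vol N u (real n) \<le> D")
      case True
      have "real (card S) * (1 / D) = (\<Sum>z\<in>S. 1 / D)" by simp
      also have "\<dots> \<le> (\<Sum>z\<in>S. cvert N z)" using True by (intro sum_mono) (simp add: S_def)
      also have "\<dots> \<le> vol N u (real n)"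
        unfolding vol_def by (intro sum_mono2 finite_ball wf cvert_nonneg) (auto simp: S_def)
      finally have "real (card S) * (1 / D) \<le> D" using True by simp
      then show ?thesis using D by (simp add: field_simps power2_eq_square)
    qed (simp add: S_def)
    then have "real (card S) * (real n + 1) \<le> D\<^sup>2 * (real n + 1)"
      by (intro mult_right_mono) auto
    from this card show "real (card S) * (real n + 1) \<le> 2 ^ (m - 1)" by (rule order_trans)
    fix xs assume xs: "length xs = Suc n" "hd xs = u" "is_path N xs"
    show "\<Psi> xs \<le> 0 \<or> (\<exists>z\<in>S. \<exists>t\<le>n. \<Psi> xs \<le> (mart N z xs t)\<^sup>2)"
    proof (cases "1 / D \<le> cvert N (last xs) \<and> vol N (last xs) (2 * real n) \<le> D")
      case True
      have "xs \<noteq> []" using xs by auto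
      have l: "last xs \<in> ball N u (real n)" using walk_in_ball[OF xs(3,1)] xs by simp
      have "u \<in> ball N (last xs) (real n)"
        using walk_in_ball[OF is_path_rev[OF wf xs(3)], of n] xs \<open>xs \<noteq> []\<close>
        by (simp add: hd_rev last_rev)
      \<comment> \<open>This is why the test uses radius 2 n: a passed test at the endpoint bounds
        the volume around the start, so the first branch of \<open>S\<close> applies.\<close>
      then have "ball N u (real n) \<subseteq> ball N (last xs) (2 * real n)"
        using ball_trans[of u N "last xs" "real n" _ "real n"] by auto
      then have "vol N u (real n) \<le> vol N (last xs) (2 * real n)"
        unfolding vol_def by (intro sum_mono2 finite_ball wf cvert_nonneg)
      then have "last xs \<in> S" using True l by (simp add: S_def)
      moreover obtain t where "t \<le> n" "\<Psi> xs = (mart N (last xs) xs t)\<^sup>2"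
        using mart_max_attained[of n N "last xs" xs] True by (auto simp: \<Psi>_def)
      ultimately show ?thesis by (metis order.refl)
    qed (auto simp: \<Psi>_def)
  qed (rule m)
  finally show ?thesis .
qed

text \<open>The forward martingale has the root as its single base point and is bounded for the
  fixed network. The backward part stays as an expectation, to be treated only after integration; on
  a network with \<open>good\<close> its truncation is inactive because every walk starts at the
  root.\<close>

lemma quenched_max_sq_le:
  assumes wf: "wf_net N" and m: "m \<ge> 1" and card: "real n + 1 \<le> 2 ^ (m - 1)"
    and good: "1 / D \<le> cvert N (root N)" "vol N (root N) (2 * real n) \<le> D"
  shows "ennreal (quenched_max_sq N n) \<le> 1 + ennreal (24 * real m) * cum_energy N n (root N) +
    4 * walk_expect N n (root N) (back_term n D N) + 2 * cum_energy N (Suc n) (root N)"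
proof -
  let ?r = "root N"
  have r: "?r \<in> verts N" using wf by (simp add: wf_net_def)
  have "ennreal (quenched_max_sq N n) \<le> walk_expect N n ?r (\<lambda>xs. ennreal (mart_max N (hd xs) n xs) +
      (4 * back_term n D N xs + 2 * (\<Sum>i\<le>n. ennreal (energy N (xs ! i)))))"
    unfolding quenched_max_sq_eq[OF wf]
  proof (rule walk_expect_mono)
    fix xs :: "nat list" assume xs: "length xs = Suc n" "hd xs = ?r" "is_path N xs"
    have "max_sq N n xs \<le> mart_max N (hd xs) n xs + 4 * mart_max N (hd xs) n (rev xs) + 2 * (\<Sum>i\<le>n. energy N (xs ! i))"
      unfolding max_sq_alt
    proof (intro Max.boundedI; clarsimp)
      fix t assume t: "t \<le> n"
      have "xs ! t \<in> verts N" using path_in_verts[OF wf xs(3)] xs r t by simp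
      then show "(wdist N ?r (xs ! t))\<^sup>2 \<le>
          mart_max N (hd xs) n xs + 4 * mart_max N (hd xs) n (rev xs) + 2 * (\<Sum>i\<le>n. energy N (xs ! i))"
        using rdist_sq_le[OF wf _ xs(1) t] xs(2) r by (simp add: rdist_eq_wdist[OF wf])
    qed
    then have "ennreal (max_sq N n xs) \<le>
        ennreal (mart_max N (hd xs) n xs + (4 * mart_max N (hd xs) n (rev xs) + 2 * (\<Sum>i\<le>n. energy N (xs ! i))))"
      by (intro ennreal_leI) (simp add: add.assoc)
    also have "\<dots> = ennreal (mart_max N (hd xs) n xs) +
      (4 * back_term n D N xs + 2 * (\<Sum>i\<le>n. ennreal (energy N (xs ! i))))"
      using good xs(1,2)
      by (simp add: back_term_def mart_max_nonneg energy_nonneg[OF wf] sum_nonneg ennreal_mult)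
    finally show "ennreal (max_sq N n xs) \<le> ennreal (mart_max N (hd xs) n xs) +
      (4 * back_term n D N xs + 2 * (\<Sum>i\<le>n. ennreal (energy N (xs ! i))))" .
  qed
  also have "\<dots> = walk_expect N n ?r (\<lambda>xs. ennreal (mart_max N (hd xs) n xs)) +
      (4 * walk_expect N n ?r (back_term n D N) +
       2 * walk_expect N n ?r (\<lambda>xs. \<Sum>i\<le>n. ennreal (energy N (xs ! i))))"
    by (simp only: walk_expect_add walk_expect_cmult)
  also have "\<dots> \<le> (1 + ennreal (24 * real m) * cum_energy N n ?r) +
      (4 * walk_expect N n ?r (back_term n D N) + 2 * cum_energy N (Suc n) ?r)"
  proof (intro add_mono mult_left_mono walk_expect_sum_energy_le wf order.refl
      walk_expect_mart_sq_le[where S = "{?r}"])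
    fix xs :: "nat list" assume "hd xs = ?r"
    then show "mart_max N (hd xs) n xs \<le> 0 \<or> (\<exists>z\<in>{?r}. \<exists>t\<le>n. mart_max N (hd xs) n xs \<le> (mart N z xs t)\<^sup>2)"
      using mart_max_attained[of n N ?r xs] by auto
  qed (use r m card in auto)
  finally show ?thesis by (simp add: add.assoc)
qed

section \<open>Annealed estimates\<close>

lemma measurable_energy [measurable]: "(\<lambda>N. energy N u) \<in> borel_measurable net_sa"
  unfolding energy_def by (rule borel_measurable_sum_random_set) measurable

lemma measurable_drift [measurable]: "(\<lambda>N. drift N z u) \<in> borel_measurable net_sa"
  unfolding drift_def by (rule borel_measurable_sum_random_set) measurable

lemma measurable_mart [measurable]: "(\<lambda>N. mart N z xs t) \<in> borel_measurable net_sa"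
  unfolding mart_def incr_def by measurable

lemma measurable_mart_max [measurable]: "(\<lambda>N. mart_max N z n xs) \<in> borel_measurable net_sa"
  unfolding mart_max_def by (rule borel_measurable_Max) auto

lemma measurable_cum_energy: "(\<lambda>N. cum_energy N n (root N)) \<in> borel_measurable net_sa"
  unfolding cum_energy_def
  by (intro borel_measurable_sum
      measurable_at_root[where f = "\<lambda>N u. walk_expect N _ u (\<lambda>xs. ennreal (energy N (last xs)))"]
      measurable_walk_expect) measurable

lemma energy_relabel: "bij \<pi> \<Longrightarrow> energy (relabel \<pi> N) (\<pi> u) = energy N u"
  by (simp add: energy_def nbrs_relabel sum_relabel trans_prob_relabel mark_relabel)

lemma drift_relabel: "bij \<pi> \<Longrightarrow> drift (relabel \<pi> N) (\<pi> z) (\<pi> u) = drift N z u"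
  by (simp add: drift_def nbrs_relabel sum_relabel trans_prob_relabel rdist_relabel)

lemma incr_relabel: "bij \<pi> \<Longrightarrow> incr (relabel \<pi> N) (\<pi> z) (\<pi> u) (\<pi> v) = incr N z u v"
  by (simp add: incr_def drift_relabel rdist_relabel)

lemma mart_relabel:
  assumes "bij \<pi>" "t < length xs"
  shows "mart (relabel \<pi> N) (\<pi> z) (map \<pi> xs) t = mart N z xs t"
  unfolding mart_def using assms by (intro sum.cong refl) (simp add: incr_relabel)

lemma mart_max_relabel:
  assumes "bij \<pi>" "n < length xs"
  shows "mart_max (relabel \<pi> N) (\<pi> z) n (map \<pi> xs) = mart_max N z n xs"
  unfolding mart_max_def using assms
  by (intro arg_cong[where f = Max] image_cong refl) (simp add: mart_relabel)

lemma path_functional_energy_last: "path_functional (\<lambda>N xs. ennreal (energy N (last xs)))"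
  by (auto simp: path_functional_def last_map energy_relabel) (simp add: energy_def)

lemma path_functional_back_term: "path_functional (back_term n D)"
  unfolding path_functional_def
proof (intro conjI allI impI)
  show "(\<lambda>N. back_term n D N xs) \<in> borel_measurable net_sa" for xs
    unfolding back_term_def by measurable
  show "back_term n D (N\<lparr>root := r\<rparr>) xs = back_term n D N xs" for N r xs
    by (simp add: back_term_def mart_max_def mart_def incr_def drift_def)
  show "back_term n D (relabel \<pi> N) (map \<pi> xs) = back_term n D N xs" if "bij \<pi>" "xs \<noteq> []" for \<pi> N xs
    using that by (auto simp: back_term_def hd_map cvert_relabel vol_relabel mart_max_relabel rev_map)
qed

text \<open>Defined for all networks, including those whose root fails the truncation test, so its
  mean is taken without conditioning. The test at the root enters only when \<open>upper\<close> is
  compared with \<open>quenched_max_sq\<close>.\<close>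

definition upper :: "nat \<Rightarrow> nat \<Rightarrow> real \<Rightarrow> net \<Rightarrow> ennreal" where
  "upper n m D N = 1 + ennreal (24 * real m) * cum_energy N n (root N) +
    4 * walk_expect N n (root N) (back_term n D N) + 2 * cum_energy N (Suc n) (root N)"

lemma measurable_walk_expect_back_term:
  "(\<lambda>N. walk_expect N n (root N) (back_term n D N)) \<in> borel_measurable net_sa"
  using path_functional_back_term[of n D] unfolding path_functional_def
  by (intro measurable_at_root[where f = "\<lambda>N u. walk_expect N n u (back_term n D N)"] measurable_walk_expect) auto

context
  fixes M :: "net measure"
  assumes sets: "sets M = sets net_sa" and wf: "AE N in M. wf_net N" and rev: "reversible_net M"
begin

text \<open>Reversing the path moves the energy at X_i to X_0; under the annealed law each time
  therefore contributes at most the mean energy at the root.\<close>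

lemma nn_integral_cum_energy_le:
  "(\<integral>\<^sup>+ N. cum_energy N n (root N) \<partial>M) \<le> of_nat n * (\<integral>\<^sup>+ N. ennreal (energy N (root N)) \<partial>M)"
proof -
  have le: "(\<integral>\<^sup>+ N. walk_expect N i (root N) (\<lambda>xs. ennreal (energy N (last xs))) \<partial>M) \<le>
      (\<integral>\<^sup>+ N. ennreal (energy N (root N)) \<partial>M)" for i
  proof -
    have "(\<integral>\<^sup>+ N. walk_expect N i (root N) (\<lambda>xs. ennreal (energy N (last xs))) \<partial>M) =
        (\<integral>\<^sup>+ N. walk_expect N i (root N) (\<lambda>xs. ennreal (energy N (last (rev xs)))) \<partial>M)"
      by (rule nn_integral_walk_expect_rev[OF sets rev path_functional_energy_last])
    also have "\<dots> \<le> (\<integral>\<^sup>+ N. ennreal (energy N (root N)) \<partial>M)"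
    proof (rule nn_integral_mono_AE, use wf in eventually_elim)
      fix N assume N: "wf_net N"
      have "walk_expect N i (root N) (\<lambda>xs. ennreal (energy N (last (rev xs)))) =
          walk_expect N i (root N) (\<lambda>_. ennreal (energy N (root N)))"
        by (rule walk_expect_cong) (auto simp: last_rev)
      then show "walk_expect N i (root N) (\<lambda>xs. ennreal (energy N (last (rev xs)))) \<le> ennreal (energy N (root N))"
        using walk_expect_const_le[OF N] by simp
    qed
    finally show ?thesis .
  qed
  have "(\<integral>\<^sup>+ N. cum_energy N n (root N) \<partial>M) =
      (\<Sum>i<n. \<integral>\<^sup>+ N. walk_expect N i (root N) (\<lambda>xs. ennreal (energy N (last xs))) \<partial>M)"
    unfolding cum_energy_def
  proof (rule nn_integral_sum)
    fix i
    have "(\<lambda>N. walk_expect N i (root N) (\<lambda>xs. ennreal (energy N (last xs)))) \<in> borel_measurable net_sa"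
      by (rule measurable_at_root[where f = "\<lambda>N u. walk_expect N i u (\<lambda>xs. ennreal (energy N (last xs)))"],
          rule measurable_walk_expect) measurable
    then show "(\<lambda>N. walk_expect N i (root N) (\<lambda>xs. ennreal (energy N (last xs)))) \<in> borel_measurable M"
      using sets by (simp cong: measurable_cong_sets)
  qed
  also have "\<dots> \<le> (\<Sum>i<n. \<integral>\<^sup>+ N. ennreal (energy N (root N)) \<partial>M)"
    by (rule sum_mono) (rule le)
  finally show ?thesis by simp
qed

lemma measurable_upper: "upper n m D \<in> borel_measurable M"
proof -
  note measurable_cum_energy [measurable] measurable_walk_expect_back_term [measurable]
  have "upper n m D \<in> borel_measurable net_sa"
    unfolding upper_def[abs_def] by measurable
  then show ?thesis using sets by (simp cong: measurable_cong_sets)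
qed

lemma nn_integral_upper_le:
  assumes prob: "prob_space M" and D: "0 < D" and n: "n \<ge> 1" and m: "m \<ge> 1"
    and card: "D\<^sup>2 * (real n + 1) \<le> 2 ^ (m - 1)"
  shows "(\<integral>\<^sup>+ N. upper n m D N \<partial>M) \<le>
    ennreal (124 * real m * real n) * (1 + (\<integral>\<^sup>+ N. ennreal (energy N (root N)) \<partial>M))"
proof -
  interpret prob_space M by (rule prob)
  note measurable_cum_energy[unfolded measurable_cong_sets[OF sets[symmetric] refl], measurable]
    measurable_walk_expect_back_term[unfolded measurable_cong_sets[OF sets[symmetric] refl], measurable]
  define H where "H = (\<integral>\<^sup>+ N. ennreal (energy N (root N)) \<partial>M)"
  have c: "(\<integral>\<^sup>+ N. cum_energy N k (root N) \<partial>M) \<le> ennreal (real k) * H" for k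
    using nn_integral_cum_energy_le[of k] by (simp add: H_def ennreal_of_nat_eq_real_of_nat)
  have "(\<integral>\<^sup>+ N. walk_expect N n (root N) (back_term n D N) \<partial>M) =
      (\<integral>\<^sup>+ N. walk_expect N n (root N) (\<lambda>xs. back_term n D N (rev xs)) \<partial>M)"
    by (rule nn_integral_walk_expect_rev[OF sets rev path_functional_back_term])
  also have "\<dots> \<le> (\<integral>\<^sup>+ N. 1 + ennreal (24 * real m) * cum_energy N n (root N) \<partial>M)"
  proof (rule nn_integral_mono_AE, use wf in eventually_elim)
    fix N assume N: "wf_net N"
    then have "root N \<in> verts N" by (simp add: wf_net_def)
    then show "walk_expect N n (root N) (\<lambda>xs. back_term n D N (rev xs)) \<le>
        1 + ennreal (24 * real m) * cum_energy N n (root N)"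
      using walk_expect_back_term_le[OF N _ D card m] by simp
  qed
  also have "\<dots> = 1 + ennreal (24 * real m) * (\<integral>\<^sup>+ N. cum_energy N n (root N) \<partial>M)"
    by (simp add: nn_integral_add nn_integral_cmult emeasure_space_1)
  also have "\<dots> \<le> 1 + ennreal (24 * real m) * (ennreal (real n) * H)"
    by (intro add_left_mono mult_left_mono c) auto
  finally have b: "(\<integral>\<^sup>+ N. walk_expect N n (root N) (back_term n D N) \<partial>M) \<le>
      1 + ennreal (24 * real m) * (ennreal (real n) * H)" .
  have "(\<integral>\<^sup>+ N. upper n m D N \<partial>M) = 1 + ennreal (24 * real m) * (\<integral>\<^sup>+ N. cum_energy N n (root N) \<partial>M) +
      4 * (\<integral>\<^sup>+ N. walk_expect N n (root N) (back_term n D N) \<partial>M) +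
      2 * (\<integral>\<^sup>+ N. cum_energy N (Suc n) (root N) \<partial>M)"
    unfolding upper_def by (simp add: nn_integral_add nn_integral_cmult emeasure_space_1)
  also have "\<dots> \<le> 1 + ennreal (24 * real m) * (ennreal (real n) * H) +
      4 * (1 + ennreal (24 * real m) * (ennreal (real n) * H)) + 2 * (ennreal (real (Suc n)) * H)"
    by (intro add_mono mult_left_mono c b) auto
  \<comment> \<open>The 5 is 1 + 4. The two martingale parts give (24 + 96) m n, and 2 (n + 1) is at
    most 4 m n, whence 124.\<close>
  also have "\<dots> = 5 + ennreal (24 * real m * real n + 4 * (24 * real m * real n) + 2 * real (Suc n)) * H"
  proof -
    have "ennreal (24 * real m * real n + 4 * (24 * real m * real n) + 2 * real (Suc n)) =
        ennreal (24 * real m) * ennreal (real n) + 4 * (ennreal (24 * real m) * ennreal (real n)) +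
        2 * ennreal (real (Suc n))"
      by (simp only: ennreal_plus ennreal_mult[symmetric] ennreal_numeral[symmetric]
          of_nat_0_le_iff mult_nonneg_nonneg add_nonneg_nonneg zero_le_numeral)
    then show ?thesis by (simp add: distrib_right distrib_left add_ac mult.assoc)
  qed
  also have "\<dots> \<le> ennreal (124 * real m * real n) * 1 + ennreal (124 * real m * real n) * H"
  proof (intro add_mono mult_right_mono)
    have mn: "real n \<le> real m * real n" "1 \<le> real m * real n"
      using m n by (auto simp flip: of_nat_mult)
    show "5 \<le> ennreal (124 * real m * real n) * 1"
      using mn(2) by (simp flip: ennreal_numeral)
    show "ennreal (24 * real m * real n + 4 * (24 * real m * real n) + 2 * real (Suc n)) \<le>
        ennreal (124 * real m * real n)"
    proof (rule ennreal_leI)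
      define p where "p = real m * real n"
      have "24 * p + 4 * (24 * p) + 2 * (real n + 1) \<le> 124 * p"
        using mn unfolding p_def[symmetric] by (simp add: algebra_simps)
      then show "24 * real m * real n + 4 * (24 * real m * real n) + 2 * real (Suc n) \<le> 124 * real m * real n"
        by (simp add: p_def mult.assoc)
    qed
  qed auto
  also have "\<dots> = ennreal (124 * real m * real n) * (1 + H)"
    by (simp add: distrib_left)
  finally show ?thesis by (simp add: H_def)
qed

end

section \<open>From dyadic times to all times\<close>

text \<open>Undoing both logarithms requires V R > 1. Otherwise the iterated logarithm may be a
  default value, but the claim is trivial because the right side is at least 1.\<close>

lemma eventually_vol_le:
  fixes V :: "real \<Rightarrow> real"
  assumes lim: "((\<lambda>R. ln (ln (V R)) / ln R) \<longlongrightarrow> 0) at_top" and e: "0 < e"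
  shows "eventually (\<lambda>R. V R \<le> exp (R powr e)) at_top"
proof -
  have "eventually (\<lambda>R. ln (ln (V R)) / ln R < e) at_top"
    using order_tendstoD(2)[OF lim e] .
  then show ?thesis using eventually_gt_at_top[of 1]
  proof eventually_elim
    case (elim R)
    show ?case
    proof (cases "V R \<le> 1")
      case True
      then show ?thesis by (rule order_trans) simp
    next
      case False
      have "ln (ln (V R)) < e * ln R" using elim by (simp add: field_simps)
      then have "exp (ln (ln (V R))) < exp (e * ln R)" by simp
      then have "ln (V R) < R powr e" using False elim by (simp add: powr_def)
      then have "exp (ln (V R)) < exp (R powr e)" by simp
      then show ?thesis using False by simp
    qed
  qed
qed

lemma filterlim_realpow_at_top: "1 < b \<Longrightarrow> filterlim (\<lambda>k. b ^ k :: real) at_top sequentially"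
  by (rule filterlim_at_infinity_imp_filterlim_at_top) (auto intro: filterlim_realpow_sequentially_gt1)

text \<open>Rounding n up to a power of 2 costs at most the constant 2^(1 + e), which an extra
  factor n^e eventually absorbs.\<close>

lemma eventually_le_of_dyadic:
  fixes Q :: "nat \<Rightarrow> real"
  assumes mono: "\<And>n k. n \<le> k \<Longrightarrow> Q n \<le> Q k" and e: "0 < e"
    and dyadic: "eventually (\<lambda>k. Q (2 ^ k) \<le> real (2 ^ k) powr (1 + e)) sequentially"
  shows "eventually (\<lambda>n. Q n \<le> real n powr (1 + 2 * e)) sequentially"
proof -
  obtain k0 where k0: "\<And>k. k \<ge> k0 \<Longrightarrow> Q (2 ^ k) \<le> real (2 ^ k) powr (1 + e)"
    using dyadic by (auto simp: eventually_sequentially)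
  \<comment> \<open>The solution of K^e = 2^(1 + e).\<close>
  define K :: real where "K = 2 powr ((1 + e) / e)"
  have "2 powr (1 + e) \<le> real n powr e" if "nat \<lceil>K\<rceil> \<le> n" for n
  proof -
    have "K \<le> real n" "0 \<le> K" using that by (linarith, simp add: K_def)
    then have "K powr e \<le> real n powr e" using e by (intro powr_mono2) auto
    then show ?thesis using e by (simp add: K_def powr_powr)
  qed
  then have "eventually (\<lambda>n. 2 powr (1 + e) \<le> real n powr e) sequentially"
    unfolding eventually_sequentially by blast
  then show ?thesis using eventually_ge_at_top[of "Suc (Suc (2 ^ k0))"]
  proof eventually_elim
    case (elim n)
    then have "2 \<le> n" by simp
    then obtain j where j: "2 ^ j < n" "n \<le> 2 ^ (j + 1)"
      using ex_power_ivl2[of 2 n] by auto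
    have "(2::nat) ^ k0 < 2 ^ (j + 1)" using j elim by linarith
    then have "k0 \<le> j + 1" by (metis less_imp_le power_less_imp_less_exp one_less_numeral_iff semiring_norm(76))
    have "Q n \<le> Q (2 ^ (j + 1))" by (rule mono) (rule j)
    also have "\<dots> \<le> real (2 ^ (j + 1)) powr (1 + e)" by (rule k0) fact
    also have "\<dots> \<le> (2 * real n) powr (1 + e)"
    proof (rule powr_mono2)
      have "2 * 2 ^ j \<le> 2 * n" using j by simp
      then show "real (2 ^ (j + 1)) \<le> 2 * real n" by (metis of_nat_le_iff of_nat_mult of_nat_numeral power_Suc Suc_eq_plus1)
    qed (use e in auto)
    also have "\<dots> = 2 powr (1 + e) * real n powr (1 + e)" by (simp add: powr_mult)
    also have "\<dots> \<le> real n powr e * real n powr (1 + e)"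
      using elim by (intro mult_right_mono) auto
    also have "\<dots> = real n powr (1 + 2 * e)" by (simp add: add_ac flip: powr_add)
    finally show ?case .
  qed
qed

text \<open>Markov and Borel-Cantelli in one: a series with finite mean converges almost surely, so
  its terms tend to 0.\<close>

lemma eventually_le_one_of_nn_integral_suminf:
  fixes f :: "nat \<Rightarrow> 'a \<Rightarrow> ennreal"
  assumes [measurable]: "\<And>k. f k \<in> borel_measurable M"
    and fin: "(\<Sum>k. \<integral>\<^sup>+ x. f k x \<partial>M) \<noteq> \<infinity>"
  shows "AE x in M. eventually (\<lambda>k. f k x \<le> 1) sequentially"
proof -
  have "(\<integral>\<^sup>+ x. (\<Sum>k. f k x) \<partial>M) \<noteq> \<infinity>"
    using fin by (subst nn_integral_suminf) auto
  then have "AE x in M. (\<Sum>k. f k x) \<noteq> \<infinity>"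
    by (intro nn_integral_PInf_AE) auto
  then show ?thesis
  proof eventually_elim
    case (elim x)
    have "f k x \<noteq> \<top>" for k
      using elim sum_le_suminf[of "\<lambda>k. f k x" "{k}"] by (auto simp: top_unique)
    then have eq: "f k x = ennreal (enn2real (f k x))" for k
      by (simp add: less_top)
    have "summable (\<lambda>k. enn2real (f k x))"
      using elim eq by (intro summable_suminf_not_top) auto
    then have "(\<lambda>k. enn2real (f k x)) \<longlonglongrightarrow> 0" by (rule summable_LIMSEQ_zero)
    then have "eventually (\<lambda>k. enn2real (f k x) < 1) sequentially"
      by (rule order_tendstoD) simp
    then show ?case
      by eventually_elim (subst eq, simp)
  qed
qed

lemma AE_dyadic_bound:
  fixes M :: "net measure" and e :: real
  assumes prob: "prob_space M" and sets: "sets M = sets net_sa" and wf: "AE N in M. wf_net N"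
    and rev: "reversible_net M"
    and vol: "AE N in M. ((\<lambda>R. ln (ln (vol N (root N) R)) / ln R) \<longlongrightarrow> 0) at_top"
    and energy: "(\<integral>\<^sup>+ N. ennreal (energy N (root N)) \<partial>M) \<noteq> \<infinity>" and e: "0 < e"
  shows "AE N in M. eventually (\<lambda>k. quenched_max_sq N (2 ^ k) \<le> real (2 ^ k) powr (1 + 4 * e)) sequentially"
proof -
  \<comment> \<open>With n = 2^k this makes y^k = n^e, b^k = n^(2e) and \<open>c k\<close> = n^(1 +
    4e). The threshold \<open>D k\<close> is a power of 2, with exponent about n^(2e).\<close>
  define y where "y = 2 powr e"
  have y1: "1 < y" using e by (simp add: y_def)
  define b where "b = y\<^sup>2"
  have b1: "1 < b" using y1 by (simp add: b_def one_less_power)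
  define J where "J k = nat \<lceil>b ^ k\<rceil>" for k :: nat
  define D :: "nat \<Rightarrow> real" where "D k = 2 ^ J k" for k
  \<comment> \<open>The least value for which 2^(m - 1) equals D^2 * 2^(k + 1), which covers D^2
    base points and 2^k + 1 times.\<close>
  define m where "m k = 2 * J k + k + 2" for k
  define c where "c k = (2 * b\<^sup>2) ^ k" for k :: nat
  define f where "f k N = ennreal (1 / c k) * upper (2 ^ k) (m k) (D k) N" for k N
  define H where "H = 1 + (\<integral>\<^sup>+ N. ennreal (energy N (root N)) \<partial>M)"
  have c0: "0 < c k" for k using b1 by (simp add: c_def)
  have J: "b ^ k \<le> real (J k)" "real (J k) \<le> b ^ k + 1" for k
    using b1 by (simp_all add: J_def real_nat_ceiling_ge of_nat_ceiling)
  have card: "(D k)\<^sup>2 * (real (2 ^ k) + 1) \<le> 2 ^ (m k - 1)" for k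
  proof -
    have "(D k)\<^sup>2 * (real (2 ^ k) + 1) \<le> (D k)\<^sup>2 * (2 ^ k + 2 ^ k)"
      by (intro mult_left_mono add_mono) auto
    also have "\<dots> = 2 ^ (m k - 1)"
      by (simp add: D_def m_def power_add mult_ac flip: power_mult)
    finally show ?thesis .
  qed
  \<comment> \<open>Of the normalisation (2 b^2)^k, the factor 2^k cancels the time, one b^k cancels
    the growth of \<open>m k\<close>, and the other b^k makes the means summable.\<close>
  have int_f: "(\<integral>\<^sup>+ N. f k N \<partial>M) \<le> ennreal (124 * 6 * (real (Suc k) * (1 / b) ^ k)) * H" for k
  proof -
    have "(\<integral>\<^sup>+ N. f k N \<partial>M) = ennreal (1 / c k) * (\<integral>\<^sup>+ N. upper (2 ^ k) (m k) (D k) N \<partial>M)"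
      unfolding f_def by (rule nn_integral_cmult) (rule measurable_upper[OF sets wf rev])
    also have "\<dots> \<le> ennreal (1 / c k) * (ennreal (124 * real (m k) * real (2 ^ k)) * H)"
      unfolding H_def using card[of k]
      by (intro mult_left_mono nn_integral_upper_le[OF sets wf rev prob]) (auto simp: D_def m_def)
    also have "\<dots> = ennreal (1 / c k * (124 * real (m k) * real (2 ^ k))) * H"
      using c0[of k] by (subst ennreal_mult) (auto simp: mult.assoc)
    also have "\<dots> \<le> ennreal (124 * 6 * (real (Suc k) * (1 / b) ^ k)) * H"
    proof (intro mult_right_mono ennreal_leI)
      have bk: "1 \<le> b ^ k" using b1 by simp
      have "real (m k) \<le> 2 * (b ^ k + 1) + real k + 2" using J(2)[of k] by (simp add: m_def)
      also have "\<dots> \<le> 6 * (real (Suc k) * b ^ k)"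
        using bk mult_left_mono[OF bk, of "real k"] by (simp add: algebra_simps)
      finally have "real (m k) \<le> 6 * (real (Suc k) * b ^ k)" .
      then have "1 / c k * (124 * real (m k) * real (2 ^ k)) \<le> 1 / c k * (124 * (6 * (real (Suc k) * b ^ k)) * real (2 ^ k))"
        using c0[of k] by (intro mult_left_mono mult_right_mono) auto
      also have "\<dots> = 124 * 6 * (real (Suc k) * (1 / b) ^ k)"
        using b1 by (simp add: c_def power_mult_distrib power2_eq_square power_divide field_simps)
      finally show "1 / c k * (124 * real (m k) * real (2 ^ k)) \<le> 124 * 6 * (real (Suc k) * (1 / b) ^ k)" .
    qed auto
    finally show ?thesis .
  qed
  have "summable (\<lambda>k. real (Suc k) * (1 / b) ^ k)"
    using geometric_deriv_sums[of "1 / b"] b1 by (auto simp: sums_iff)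
  then have sum: "summable (\<lambda>k. 124 * 6 * (real (Suc k) * (1 / b) ^ k))"
    by (rule summable_mult)
  have "(\<Sum>k. \<integral>\<^sup>+ N. f k N \<partial>M) \<le> (\<Sum>k. ennreal (124 * 6 * (real (Suc k) * (1 / b) ^ k)) * H)"
    by (intro suminf_le int_f) auto
  also have "\<dots> = ennreal (\<Sum>k. 124 * 6 * (real (Suc k) * (1 / b) ^ k)) * H"
    unfolding ennreal_suminf_multc using b1 sum by (subst suminf_ennreal2) auto
  also have "\<dots> < \<infinity>"
    using energy by (auto simp: H_def ennreal_mult_less_top less_top)
  finally have "AE N in M. eventually (\<lambda>k. f k N \<le> 1) sequentially"
    by (intro eventually_le_one_of_nn_integral_suminf)
       (auto simp: f_def intro!: borel_measurable_times_ennreal measurable_upper[OF sets wf rev])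
  moreover have "AE N in M. 0 < cvert N (root N)" using rev by (simp add: reversible_net_def)
  ultimately show ?thesis using wf vol
  proof eventually_elim
    case (elim N)
    have lim_b: "filterlim (\<lambda>k. b ^ k) at_top sequentially" and lim_y: "filterlim (\<lambda>k. y ^ k) at_top sequentially"
      using b1 y1 by (simp_all add: filterlim_realpow_at_top)
    have good1: "eventually (\<lambda>k. 1 / D k \<le> cvert N (root N)) sequentially"
    proof -
      have "eventually (\<lambda>k. 1 / cvert N (root N) \<le> b ^ k) sequentially"
        using lim_b by (simp add: filterlim_at_top)
      then show ?thesis
      proof eventually_elim
        case (elim k)
        have "b ^ k \<le> D k" using J(1)[of k] of_nat_less_two_power[of "J k"]
          unfolding D_def by (meson less_imp_le order_trans)
        then have "1 / cvert N (root N) \<le> D k" using elim by simp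
        moreover have "0 < D k" by (simp add: D_def)
        ultimately show ?case using \<open>0 < cvert N (root N)\<close> by (simp add: field_simps)
      qed
    qed
    have good2: "eventually (\<lambda>k. vol N (root N) (2 * real (2 ^ k)) \<le> D k) sequentially"
    proof -
      have "filterlim (\<lambda>k. 2 * real (2 ^ k)) at_top sequentially"
        by (rule filterlim_tendsto_pos_mult_at_top[OF tendsto_const])
           (auto intro: filterlim_realpow_at_top)
      from filterlim_iff[THEN iffD1, OF this, rule_format, OF eventually_vol_le[OF elim(4) e]]
      have "eventually (\<lambda>k. vol N (root N) (2 * real (2 ^ k)) \<le> exp ((2 * real (2 ^ k)) powr e)) sequentially" .
      moreover have "eventually (\<lambda>k. y / ln 2 \<le> y ^ k) sequentially"
        using lim_y by (simp add: filterlim_at_top)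
      ultimately show ?thesis
      proof eventually_elim
        case (elim k)
        have "(2 * real (2 ^ k)) powr e = y * y ^ k"
          by (simp add: y_def powr_mult powr_power mult.commute powr_powr flip: powr_realpow)
        \<comment> \<open>The volume exponent is only of order y^k while \<open>D k\<close> allows
          b^k = y^k * y^k. The spare factor eventually absorbs y / ln 2, which comes from the
          doubled radius and the change of base from e to 2.\<close>
        also have "\<dots> \<le> (ln 2 * y ^ k) * y ^ k"
          using elim(2) y1 by (intro mult_right_mono) (auto simp: field_simps)
        also have "\<dots> = ln 2 * b ^ k" by (simp add: b_def power2_eq_square power_mult_distrib)
        also have "\<dots> \<le> ln 2 * real (J k)" by (intro mult_left_mono J) auto
        finally have "exp ((2 * real (2 ^ k)) powr e) \<le> exp (ln 2 * real (J k))" by simp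
        also have "\<dots> = D k" by (simp add: D_def mult.commute exp_of_nat_mult)
        finally show ?case using elim(1) by simp
      qed
    qed
    show ?case using good1 good2 elim(1)
    proof eventually_elim
      case (elim k)
      have "real (2 ^ k) + 1 \<le> 2 ^ (m k - 1)"
      proof -
        have "1 * (real (2 ^ k) + 1) \<le> (D k)\<^sup>2 * (real (2 ^ k) + 1)"
          by (intro mult_right_mono) (auto simp: D_def one_le_power)
        then show ?thesis using card[of k] by simp
      qed
      then have "ennreal (quenched_max_sq N (2 ^ k)) \<le> upper (2 ^ k) (m k) (D k) N"
        unfolding upper_def using elim by (intro quenched_max_sq_le \<open>wf_net N\<close>) (auto simp: m_def)
      also have "\<dots> = ennreal (c k) * f k N"
        using c0[of k] by (simp add: f_def mult.assoc[symmetric] flip: ennreal_mult)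
      also have "\<dots> \<le> ennreal (c k) * 1" by (intro mult_left_mono elim) simp
      finally have "quenched_max_sq N (2 ^ k) \<le> c k" using c0[of k] by (simp add: ennreal_le_iff)
      also have "c k = real (2 ^ k) powr (1 + 4 * e)"
      proof -
        have "b\<^sup>2 = 2 powr (4 * e)" by (simp add: b_def y_def powr_power mult.commute)
        then have "2 * b\<^sup>2 = 2 powr (1 + 4 * e)" by (simp add: powr_add)
        then show ?thesis by (simp add: c_def powr_power powr_powr mult.commute flip: powr_realpow)
      qed
      finally show ?case .
    qed
  qed
qed

theorem theorem1p5:
  fixes M :: "net measure" and \<delta> :: real
  assumes "prob_space M"
    and "sets M = sets net_sa"
    and "AE N in M. wf_net N"
    and "reversible_net M"
    and "(\<integral>\<^sup>+ N. ennreal (1 / cvert N (root N)) \<partial>M) < \<infinity>"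
    and "AE N in M. ((\<lambda>R. ln (ln (vol N (root N) R)) / ln R) \<longlongrightarrow> 0) at_top"
    and "(\<integral>\<^sup>+ N. (\<Sum>v\<in>nbrs N (root N).
            ennreal (trans_prob N (root N) v * (mark N (root N) v)\<^sup>2)) \<partial>M) < \<infinity>"
    and "\<delta> > 0"
  shows "AE N in M. eventually (\<lambda>n. quenched_max_sq N n \<le> real n powr (1 + \<delta>)) sequentially"
proof -
  have "(\<integral>\<^sup>+ N. ennreal (energy N (root N)) \<partial>M) = (\<integral>\<^sup>+ N. (\<Sum>v\<in>nbrs N (root N).
            ennreal (trans_prob N (root N) v * (mark N (root N) v)\<^sup>2)) \<partial>M)"
    by (rule nn_integral_cong_AE, use assms(3) in eventually_elim)
       (simp add: energy_def trans_prob_nonneg)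
  then have "(\<integral>\<^sup>+ N. ennreal (energy N (root N)) \<partial>M) \<noteq> \<infinity>" using assms(7) by simp
  \<comment> \<open>With e = delta / 8 the dyadic exponent is 1 + delta / 2, and the passage to all
    times doubles the excess to delta.\<close>
  from AE_dyadic_bound[OF assms(1-4,6) this, of "\<delta> / 8"] assms(8)
  have "AE N in M. eventually (\<lambda>k. quenched_max_sq N (2 ^ k) \<le> real (2 ^ k) powr (1 + \<delta> / 2)) sequentially"
    by simp
  moreover have "AE N in M. 0 < cvert N (root N)"
    using assms(4) by (simp add: reversible_net_def)
  ultimately show ?thesis using assms(3)
  proof eventually_elim
    case (elim N)
    then show ?case
      using eventually_le_of_dyadic[of "quenched_max_sq N" "\<delta> / 2"] quenched_max_sq_mono[of N] assms(8)
      by simp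
  qed
qed

end
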